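(* Let $P$ be a finite set of points in the plane, no three of which are collinear, and suppose that $P$ is 4-connectible. Then $$|P'| - |CH(P')| \;\geq\; |CH(P)| - \max|T_c'|.$$
   Context: $CH(X)$ denotes the convex hull (boundary polygon) of a finite planar point set $X$; $|CH(X)|$ is the number of points of $X$ that are vertices of it. $P'$ is the set of points of $P$ lying in the interior of $CH(P)$. A graph is 4-connected if it has at least 5 vertices and no set of 3 vertices whose removal disconnects it. $P$ is 4-connectible if there is a 4-connected plane graph with vertex set $P$ all of whose edges are line segments. An inward triangle is a triangle $abc$ where $bc$ is an edge of $CH(P)$, $a\in P'$, and no point of $P$ lies in the interior of the triangle; $a$ is called its inward vertex. For two points $p_r,p_t$ that are vertices of $CH(P)$, let $S$ be the set of vertices of $CH(P)$ strictly between $p_r$ and $p_t$ on the counterclockwise boundary of $CH(P)$ from $p_r$ to $p_t$, let $Q=P\setminus S$, and let $qchain_{cc}(p_r,p_t)$ be the set of points on the counterclockwise boundary of $CH(Q)$ from $p_r$ to $p_t$, excluding $p_r$ and $p_t$. An inward triangle $abc$ with base edge $bc$ is forbidden if, for some $p_r,p_t$, $bc$ is an edge of the clockwise boundary of $CH(P)$ from $p_r$ to $p_t$ and $a\in qchain_{cc}(p_r,p_t)$. A set $T_c$ of non-forbidden inward triangles is compatible if no two triangles in $T_c$ share an edge, an inward vertex, or an interior point; it is maximal if no inward triangle can be added to it while keeping it compatible. For such $T_c$, $T_c'\subseteq T_c$ is the set of triangles in $T_c$ whose inward vertices are vertices of $CH(P')$. $\max|T_c'|$ denotes the maximum of $|T_c'|$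 over all maximal compatible sets $T_c$. *)

theory Defs
  imports "HOL-Analysis.Analysis"
begin

definition no_three_collinear :: "(real^2) set \<Rightarrow> bool" where
  "no_three_collinear P \<longleftrightarrow>
     (\<forall>a\<in>P. \<forall>b\<in>P. \<forall>c\<in>P. a \<noteq> b \<longrightarrow> b \<noteq> c \<longrightarrow> a \<noteq> c \<longrightarrow> \<not> collinear {a, b, c})"

definition hull_vertices :: "(real^2) set \<Rightarrow> (real^2) set" where
  "hull_vertices X = {x \<in> X. x extreme_point_of (convex hull X)}"

definition interior_points :: "(real^2) set \<Rightarrow> (real^2) set" where
  "interior_points P = P \<inter> interior (convex hull P)"


text \<open>A simple graph on \<open>V\<close> is given by its set \<open>E\<close> of edges, each a two-element subset of \<open>V\<close>.\<close>

definition simple_graph :: "'a set \<Rightarrow> 'a set set \<Rightarrow> bool" where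
  "simple_graph V E \<longleftrightarrow> (\<forall>e\<in>E. e \<subseteq> V \<and> card e = 2)"

definition graph_connected :: "'a set \<Rightarrow> 'a set set \<Rightarrow> bool" where
  "graph_connected V E \<longleftrightarrow>
     (\<forall>u\<in>V. \<forall>v\<in>V. (u, v) \<in> {(x, y). x \<in> V \<and> y \<in> V \<and> {x, y} \<in> E}\<^sup>*)"

definition four_connected :: "'a set \<Rightarrow> 'a set set \<Rightarrow> bool" where
  "four_connected V E \<longleftrightarrow>
     card V \<ge> 5 \<and>
     (\<forall>S. S \<subseteq> V \<and> card S = 3 \<longrightarrow> graph_connected (V - S) {e \<in> E. e \<subseteq> V - S})"

text \<open>The edge \<open>{u, v}\<close> is drawn as the segment \<open>convex hull {u, v}\<close>.\<close>

definition plane_straight_line_graph :: "(real^2) set \<Rightarrow> (real^2) set set \<Rightarrow> bool" where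
  "plane_straight_line_graph V E \<longleftrightarrow>
     simple_graph V E \<and>
     (\<forall>e\<in>E. V \<inter> convex hull e = e) \<and>
     (\<forall>e\<in>E. \<forall>f\<in>E. e \<noteq> f \<longrightarrow> convex hull e \<inter> convex hull f \<subseteq> e \<inter> f)"

definition four_connectible :: "(real^2) set \<Rightarrow> bool" where
  "four_connectible P \<longleftrightarrow> (\<exists>E. plane_straight_line_graph P E \<and> four_connected P E)"


text \<open>Twice the signed area of the triangle \<open>a b c\<close>; positive iff \<open>c\<close> lies strictly to the left
  of the line directed from \<open>a\<close> to \<open>b\<close>.\<close>

definition orientation :: "real^2 \<Rightarrow> real^2 \<Rightarrow> real^2 \<Rightarrow> real" where
  "orientation a b c = (b$1 - a$1) * (c$2 - a$2) - (b$2 - a$2) * (c$1 - a$1)"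

text \<open>A counterclockwise step along the hull boundary, i.e. with \<open>X\<close> on the left.\<close>

definition ccw_edge :: "(real^2) set \<Rightarrow> real^2 \<Rightarrow> real^2 \<Rightarrow> bool" where
  "ccw_edge X u v \<longleftrightarrow>
     closed_segment u v edge_of (convex hull X) \<and> (\<forall>w\<in>X. orientation u v w \<ge> 0)"

text \<open>\<open>vs\<close> lists the vertices met when walking counterclockwise along the boundary of the hull
  from \<open>p\<close> to the first arrival at \<open>q\<close>; distinctness rules out further rounds.\<close>

definition ccw_walk :: "(real^2) set \<Rightarrow> real^2 \<Rightarrow> real^2 \<Rightarrow> (real^2) list \<Rightarrow> bool" where
  "ccw_walk X p q vs \<longleftrightarrow>
     vs \<noteq> [] \<and> hd vs = p \<and> last vs = q \<and> distinct vs \<and> successively (ccw_edge X) vs"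

definition ccw_strictly_between :: "(real^2) set \<Rightarrow> real^2 \<Rightarrow> real^2 \<Rightarrow> (real^2) set" where
  "ccw_strictly_between X p q = {v. \<exists>vs. ccw_walk X p q vs \<and> v \<in> set vs \<and> v \<noteq> p \<and> v \<noteq> q}"

definition ccw_boundary_edges :: "(real^2) set \<Rightarrow> real^2 \<Rightarrow> real^2 \<Rightarrow> (real^2) set set" where
  "ccw_boundary_edges X p q = {{b, c} |b c. \<exists>us ws. ccw_walk X p q (us @ b # c # ws)}"

text \<open>The clockwise boundary from \<open>p\<close> to \<open>q\<close> is the counterclockwise one from \<open>q\<close> to \<open>p\<close>.\<close>

definition cw_boundary_edges :: "(real^2) set \<Rightarrow> real^2 \<Rightarrow> real^2 \<Rightarrow> (real^2) set set" where
  "cw_boundary_edges X p q = ccw_boundary_edges X q p"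

text \<open>As no three points are collinear, every point of \<open>Q\<close> on the boundary of its hull is a
  vertex of that hull, so the walk meets all of them.\<close>

definition qchain_cc :: "(real^2) set \<Rightarrow> real^2 \<Rightarrow> real^2 \<Rightarrow> (real^2) set" where
  "qchain_cc P p q =
     (let S = ccw_strictly_between P p q; Q = P - S in ccw_strictly_between Q p q)"


text \<open>A triangle with a distinguished vertex \<open>a\<close> and opposite (base) edge \<open>{b, c}\<close> is the pair
  \<open>(a, {b, c})\<close>. For inward triangles \<open>a\<close> is the only vertex in the interior of the hull, so
  this pair is determined by the vertex set.\<close>

type_synonym triangle = "(real^2) \<times> (real^2) set"

abbreviation inward_vertex :: "triangle \<Rightarrow> real^2" where
  "inward_vertex T \<equiv> fst T"

abbreviation base_edge :: "triangle \<Rightarrow> (real^2) set" where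
  "base_edge T \<equiv> snd T"

definition triangle_interior :: "triangle \<Rightarrow> (real^2) set" where
  "triangle_interior T = interior (convex hull (insert (inward_vertex T) (base_edge T)))"

definition triangle_edges :: "triangle \<Rightarrow> (real^2) set set" where
  "triangle_edges T = insert (base_edge T) {{inward_vertex T, x} |x. x \<in> base_edge T}"

definition inward_triangle :: "(real^2) set \<Rightarrow> triangle \<Rightarrow> bool" where
  "inward_triangle P T \<longleftrightarrow>
     (\<exists>b c. base_edge T = {b, c} \<and> closed_segment b c edge_of (convex hull P)) \<and>
     inward_vertex T \<in> interior_points P \<and>
     P \<inter> triangle_interior T = {}"

definition forbidden :: "(real^2) set \<Rightarrow> triangle \<Rightarrow> bool" where
  "forbidden P T \<longleftrightarrow>
     (\<exists>p\<in>hull_vertices P. \<exists>q\<in>hull_vertices P. p \<noteq> q \<and>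
        base_edge T \<in> cw_boundary_edges P p q \<and> inward_vertex T \<in> qchain_cc P p q)"

definition compatible :: "(real^2) set \<Rightarrow> triangle set \<Rightarrow> bool" where
  "compatible P Tc \<longleftrightarrow>
     (\<forall>T\<in>Tc. inward_triangle P T \<and> \<not> forbidden P T) \<and>
     (\<forall>T\<in>Tc. \<forall>U\<in>Tc. T \<noteq> U \<longrightarrow>
        triangle_edges T \<inter> triangle_edges U = {} \<and>
        inward_vertex T \<noteq> inward_vertex U \<and>
        triangle_interior T \<inter> triangle_interior U = {})"

definition maximal_compatible :: "(real^2) set \<Rightarrow> triangle set \<Rightarrow> bool" where
  "maximal_compatible P Tc \<longleftrightarrow>
     compatible P Tc \<and>
     (\<forall>T. inward_triangle P T \<and> T \<notin> Tc \<longrightarrow> \<not> compatible P (insert T Tc))"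

text \<open>The subset \<open>T\<^sub>c'\<close> of \<open>T\<^sub>c\<close>.\<close>

definition hull_inward :: "(real^2) set \<Rightarrow> triangle set \<Rightarrow> triangle set" where
  "hull_inward P Tc = {T \<in> Tc. inward_vertex T \<in> hull_vertices (interior_points P)}"

definition max_hull_inward :: "(real^2) set \<Rightarrow> nat" where
  "max_hull_inward P = Max {card (hull_inward P Tc) |Tc. maximal_compatible P Tc}"

end

theory Submission
  imports Defs
begin

text \<open>
  Extend the given graph to a maximal straight-line plane graph on \<open>P\<close>; it is still 4-connected.
  Over every hull edge \<open>bc\<close> there is a triangular face \<open>abc\<close>. If \<open>a\<close> has neighbours \<open>b\<close>, \<open>s\<close> on the
  hull, the path \<open>b a s\<close> cuts the hull into two parts, and removing its three points
  disconnects the graph unless one part contains no further point. Hence \<open>a\<close> is interior and has no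
  hull neighbours besides \<open>b\<close> and \<open>c\<close>. So distinct hull edges have distinct apexes, and no face is
  forbidden, as an apex on the chain would be adjacent to a removed hull vertex. The
  \<open>|CH(P)|\<close> faces therefore form a maximal compatible set, and those not counted by \<open>T\<^sub>c'\<close>
  have distinct apexes in \<open>P' - CH(P')\<close>.
\<close>

section \<open>Orientation in the plane\<close>

text \<open>No notion of face and no Jordan curve enters: sidedness is the sign of
  \<open>orientation\<close>, and separation rests on the convexity of the hull. A line through an
  edge ending in a hull vertex has no hull point past that vertex, so a graph edge that changes
  sides must hit the edge itself. This is why the neighbours in question have to be hull vertices.
  Maximality supplies the opposite kind of information: a segment that no edge crosses is an edge.
  It acts in two forms. If an open half-plane bounded by a line through a point of \<open>P\<close>
  contains some point of \<open>P\<close>, it contains a neighbour of that point; and the first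
  neighbour of \<open>b\<close> after \<open>c\<close> closes a triangle with \<open>bc\<close>. The
  first form yields the contradiction for a forbidden face. The maximum is only bounded from below,
  by the set of faces. Maximality of this set is immediate, since every hull edge is already the
  base of a face in it.\<close>

lemma orientation_rotate: "orientation a b c = orientation b c a"
  by (simp add: orientation_def algebra_simps)

lemma orientation_swap: "orientation a c b = - orientation a b c"
  by (simp add: orientation_def algebra_simps)

lemma orientation_same [simp]:
  "orientation a a b = 0" "orientation a b a = 0" "orientation a b b = 0"
  by (simp_all add: orientation_def algebra_simps)

lemma orientation_convex_combination:
  "orientation a b ((1 - t) *\<^sub>R p + t *\<^sub>R q) = (1 - t) * orientation a b p + t * orientation a b q"
  by (simp add: orientation_def algebra_simps)

text \<open>The vector is \<open>b - a\<close> turned by a right angle; this carries the half-plane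
  facts for inner products over to \<open>orientation\<close>.\<close>

lemma orientation_as_inner:
  "orientation a b z = vector [a$2 - b$2, b$1 - a$1] \<bullet> z - vector [a$2 - b$2, b$1 - a$1] \<bullet> a"
  by (simp add: orientation_def inner_vec_def sum_2 algebra_simps)

text \<open>Cramer's rule in the affine frame \<open>a\<close>, \<open>x\<close>, \<open>u\<close>.
  The visibility arguments work in such coordinates, where the triangle becomes the standard
  one.\<close>

lemma orientation_coordinates:
  assumes "orientation a x u \<noteq> 0"
  shows "w = a + (orientation a w u / orientation a x u) *\<^sub>R (x - a)
               + (orientation a x w / orientation a x u) *\<^sub>R (u - a)"
proof -
  have "orientation a x u *\<^sub>R w = orientation a x u *\<^sub>R a + orientation a w u *\<^sub>R (x - a)
               + orientation a x w *\<^sub>R (u - a)"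
    by (simp add: vec_eq_iff forall_2 orientation_def algebra_simps)
  then have "(1 / orientation a x u) *\<^sub>R (orientation a x u *\<^sub>R w) =
     (1 / orientation a x u) *\<^sub>R (orientation a x u *\<^sub>R a + orientation a w u *\<^sub>R (x - a)
               + orientation a x w *\<^sub>R (u - a))" by simp
  then show ?thesis using assms by (simp add: scaleR_add_right)
qed

lemma orientation_zeroE:
  assumes "orientation a b z = 0" "a \<noteq> b"
  obtains l where "z = a + l *\<^sub>R (b - a)"
proof (cases "b$1 = a$1")
  case True
  then have "b$2 \<noteq> a$2" using assms(2) by (auto simp: vec_eq_iff forall_2)
  then have "z = a + ((z$2 - a$2) / (b$2 - a$2)) *\<^sub>R (b - a)"
    using assms(1) True by (auto simp: vec_eq_iff forall_2 orientation_def)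
  then show ?thesis by (rule that)
next
  case False
  then have d: "b$1 - a$1 \<noteq> 0" by simp
  have "z$2 - a$2 = (z$1 - a$1) / (b$1 - a$1) * (b$2 - a$2)"
    using assms(1) d by (simp add: orientation_def field_simps)
  then have "z = a + ((z$1 - a$1) / (b$1 - a$1)) *\<^sub>R (b - a)"
    using d by (simp add: vec_eq_iff forall_2)
  then show ?thesis by (rule that)
qed

lemma orientation_on_line [simp]: "orientation a b (a + l *\<^sub>R (b - a)) = 0"
  by (simp add: orientation_def algebra_simps)

lemma collinear_iff_orientation: "collinear {a, b, c} \<longleftrightarrow> orientation a b c = 0"
proof (cases "a = b")
  case True then show ?thesis by (simp add: collinear_2)
next
  case False
  have "collinear {b, a, c} \<longleftrightarrow> collinear {a, b, c}" by (simp add: insert_commute)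
  moreover have "collinear {b, c, a} \<longleftrightarrow> collinear {a, b, c}" by (metis insert_commute)
  moreover have "collinear {b, c, a} \<longleftrightarrow> (\<exists>u. c = u *\<^sub>R b + (1 - u) *\<^sub>R a)"
    using False by (simp add: collinear_3_expand)
  moreover have "(\<exists>u. c = u *\<^sub>R b + (1 - u) *\<^sub>R a) \<longleftrightarrow> orientation a b c = 0"
  proof
    assume "\<exists>u. c = u *\<^sub>R b + (1 - u) *\<^sub>R a"
    then obtain u where "c = u *\<^sub>R b + (1 - u) *\<^sub>R a" ..
    then have "c = a + u *\<^sub>R (b - a)" by (simp add: algebra_simps)
    then show "orientation a b c = 0" by simp
  next
    assume "orientation a b c = 0"
    then obtain l where "c = a + l *\<^sub>R (b - a)" using False orientation_zeroE by blast
    then have "c = l *\<^sub>R b + (1 - l) *\<^sub>R a" by (simp add: algebra_simps)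
    then show "\<exists>u. c = u *\<^sub>R b + (1 - u) *\<^sub>R a" ..
  qed
  ultimately show ?thesis by simp
qed

lemma convex_orientation_ge: "convex {z. orientation a b z \<ge> 0}"
proof -
  have "{z. orientation a b z \<ge> 0} =
    {z. vector [a$2 - b$2, b$1 - a$1] \<bullet> z \<ge> vector [a$2 - b$2, b$1 - a$1] \<bullet> a}"
    by (auto simp: orientation_as_inner)
  then show ?thesis by (simp add: convex_halfspace_ge)
qed

lemma orientation_ge_on_hull:
  assumes "\<forall>w\<in>X. orientation a b w \<ge> 0" "z \<in> convex hull X"
  shows "orientation a b z \<ge> 0"
  using hull_minimal[of X "{z. orientation a b z \<ge> 0}" convex] assms convex_orientation_ge by blast

lemma orientation_gt_on_interior:
  assumes "a \<noteq> b" "\<forall>w\<in>X. orientation a b w \<ge> 0" "z \<in> interior (convex hull X)"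
  shows "orientation a b z > 0"
proof -
  let ?n = "vector [a$2 - b$2, b$1 - a$1] :: real^2"
  have "?n \<noteq> 0" using assms(1) by (auto simp: vec_eq_iff forall_2)
  then have "interior {z. ?n \<bullet> z \<ge> ?n \<bullet> a} = {z. ?n \<bullet> z > ?n \<bullet> a}"
    by (simp add: interior_halfspace_ge)
  moreover have "convex hull X \<subseteq> {z. ?n \<bullet> z \<ge> ?n \<bullet> a}"
    using orientation_ge_on_hull[OF assms(2)] by (auto simp: orientation_as_inner)
  ultimately have "z \<in> {z. ?n \<bullet> z > ?n \<bullet> a}" using assms(3) interior_mono by blast
  then show ?thesis by (simp add: orientation_as_inner)
qed

section \<open>Exit points of segments, minimal ratios, extreme points on rays\<close>

text \<open>The minimum of the two affine functions is continuous, hence vanishes somewhere. This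
  gives the point where a segment leaves a wedge or a triangle, with the other constraint still in
  force.\<close>

lemma affine_pair_first_zero:
  fixes p q p' q' :: real
  assumes "p \<ge> 0" "p' \<ge> 0" "q \<le> 0 \<or> q' \<le> 0"
  shows "\<exists>t\<ge>0. t \<le> 1 \<and> (1 - t) * p + t * q \<ge> 0 \<and> (1 - t) * p' + t * q' \<ge> 0 \<and>
    ((1 - t) * p + t * q = 0 \<or> (1 - t) * p' + t * q' = 0)"
proof -
  let ?g = "\<lambda>t. min ((1 - t) * p + t * q) ((1 - t) * p' + t * q')"
  have "continuous_on {0..1} ?g" by (intro continuous_intros)
  moreover have "?g 1 \<le> 0" "?g 0 \<ge> 0" using assms by auto
  ultimately obtain t where "0 \<le> t" "t \<le> 1" "?g t = 0"
    using IVT2'[of ?g 1 0 0] by auto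
  then show ?thesis by (intro exI[of _ t]) (auto simp: min_def split: if_splits)
qed

lemma affine_first_zero:
  fixes p q :: real
  assumes "p \<ge> 0" "q \<le> 0"
  shows "\<exists>t\<ge>0. t \<le> 1 \<and> (1 - t) * p + t * q = 0"
  using affine_pair_first_zero[of p p q q] assms by auto

text \<open>A minimiser of \<open>m / k\<close>, cross-multiplied: in both applications the
  difference of the two sides is an orientation up to a nonzero factor.\<close>

lemma finite_min_ratio:
  fixes m k :: "'a \<Rightarrow> real"
  assumes "finite Q" "Q \<noteq> {}" "\<And>y. y \<in> Q \<Longrightarrow> k y > 0"
  obtains y where "y \<in> Q" "\<And>y'. y' \<in> Q \<Longrightarrow> m y * k y' \<le> m y' * k y"
proof -
  let ?r = "\<lambda>y. m y / k y"
  obtain y where y: "y \<in> Q" "\<And>y'. y' \<in> Q \<Longrightarrow> ?r y \<le> ?r y'"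
    using arg_min_if_finite(1)[OF assms(1,2), of ?r] arg_min_least[OF assms(1,2), of _ ?r] by blast
  have "m y * k y' \<le> m y' * k y" if "y' \<in> Q" for y'
    using y(2)[OF that] assms(3)[OF that] assms(3)[OF y(1)] by (simp add: field_simps)
  with y(1) show ?thesis by (rule that)
qed

text \<open>A point of \<open>H\<close> past \<open>b\<close> would put \<open>b\<close> strictly
  between two points of \<open>H\<close>. Hence inside the hull a ray along an edge ends where the
  edge ends, if that end is a hull vertex.\<close>

lemma extreme_not_beyond:
  fixes a b :: "'a::euclidean_space"
  assumes "b extreme_point_of H" "a \<in> H" "a + l *\<^sub>R (b - a) \<in> H" "a \<noteq> b"
  shows "l \<le> 1"
proof (rule ccontr)
  assume l: "\<not> l \<le> 1"
  let ?z = "a + l *\<^sub>R (b - a)"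
  have "b = (1 - 1/l) *\<^sub>R a + (1/l) *\<^sub>R ?z" using l by (simp add: algebra_simps)
  moreover have "a \<noteq> ?z" using l assms(4) by simp
  ultimately have "b \<in> open_segment a ?z" unfolding in_segment using l
    by (metis (no_types, lifting) divide_less_eq_1_pos less_trans not_le zero_less_divide_1_iff zero_less_one)
  then show False using assms(1-3) unfolding extreme_point_of_def by blast
qed

lemma in_closed_segment_ray: "0 \<le> l \<Longrightarrow> l \<le> 1 \<Longrightarrow> a + l *\<^sub>R (b - a) \<in> closed_segment a b"
  by (auto simp: in_segment algebra_simps)

section \<open>Separation in plane 4-connected graphs\<close>

lemma segments_with_common_end:
  assumes "orientation p q v \<noteq> 0" "z \<in> closed_segment p q" "z \<in> closed_segment p v"
  shows "z = p"
proof -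
  obtain s where s: "z = (1 - s) *\<^sub>R p + s *\<^sub>R v" using assms(3) by (auto simp: in_segment)
  obtain r where r: "z = (1 - r) *\<^sub>R p + r *\<^sub>R q" using assms(2) by (auto simp: in_segment)
  have "orientation p q z = s * orientation p q v" by (simp add: s orientation_convex_combination)
  moreover have "orientation p q z = 0" by (simp add: r orientation_convex_combination)
  ultimately have "s = 0" using assms(1) by simp
  then show ?thesis using s by simp
qed

lemma card_2_pairE:
  assumes "card e = 2" "p \<in> e"
  obtains v where "e = {p, v}" "p \<noteq> v"
  using assms by (auto simp: card_2_iff doubleton_eq_iff)

locale maximal_plane_graph =
  fixes P :: "(real^2) set" and E :: "(real^2) set set"
  assumes finite_P: "finite P"
    and no3: "no_three_collinear P"
    and plane: "plane_straight_line_graph P E"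
    and maximal: "\<And>F. E \<subseteq> F \<Longrightarrow> plane_straight_line_graph P F \<Longrightarrow> F = E"
    and four_conn: "four_connected P E"
begin

lemma orientation_nonzero:
  "a \<in> P \<Longrightarrow> b \<in> P \<Longrightarrow> c \<in> P \<Longrightarrow> a \<noteq> b \<Longrightarrow> b \<noteq> c \<Longrightarrow> a \<noteq> c \<Longrightarrow> orientation a b c \<noteq> 0"
  using no3 collinear_iff_orientation unfolding no_three_collinear_def by blast

lemma edge_subset: "e \<in> E \<Longrightarrow> e \<subseteq> P"
  and edge_card: "e \<in> E \<Longrightarrow> card e = 2"
  and edge_Int_P: "e \<in> E \<Longrightarrow> P \<inter> convex hull e = e"
  and edges_Int: "e \<in> E \<Longrightarrow> f \<in> E \<Longrightarrow> e \<noteq> f \<Longrightarrow> convex hull e \<inter> convex hull f \<subseteq> e \<inter> f"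
  using plane by (simp_all add: plane_straight_line_graph_def simple_graph_def)

lemma edgeD:
  assumes "{u, v} \<in> E"
  shows "u \<in> P" "v \<in> P" "u \<noteq> v"
proof -
  have "{u, v} \<subseteq> P" "card {u, v} = 2"
    using assms by (rule edge_subset, rule edge_card)
  then show "u \<in> P" "v \<in> P" "u \<noteq> v" by auto
qed

lemma segment_Int_P:
  assumes "u \<in> P" "v \<in> P" "w \<in> P" "w \<in> closed_segment u v"
  shows "w = u \<or> w = v"
proof (rule ccontr)
  assume n: "\<not> ?thesis"
  obtain s where s: "w = (1 - s) *\<^sub>R u + s *\<^sub>R v" using assms(4) by (auto simp: in_segment)
  have "orientation u v w = 0" by (simp add: s orientation_convex_combination)
  moreover have "u \<noteq> v" using n assms(4) by auto
  ultimately show False using n assms orientation_nonzero[of u v w] by auto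
qed

lemma edges_cross:
  assumes "{u, v} \<in> E" "{p, q} \<in> E" "{u, v} \<noteq> {p, q}"
    "z \<in> closed_segment u v" "z \<in> closed_segment p q"
  shows "z \<in> {u, v} \<inter> {p, q}"
proof -
  have "convex hull {u, v} \<inter> convex hull {p, q} \<subseteq> {u, v} \<inter> {p, q}"
    using assms(1-3) by (rule edges_Int)
  then show ?thesis using assms(4,5) by (auto simp: segment_convex_hull)
qed

text \<open>Adding \<open>{p, q}\<close> keeps the graph plane, so maximality puts it into
  \<open>E\<close>. Only edges disjoint from \<open>{p, q}\<close> matter: by general position,
  segments with one common end meet nowhere else.\<close>

lemma edge_if_uncrossed:
  assumes pq: "p \<in> P" "q \<in> P" "p \<noteq> q"
    and uncrossed: "\<And>u v z. {u, v} \<in> E \<Longrightarrow> u \<noteq> p \<Longrightarrow> u \<noteq> q \<Longrightarrow> v \<noteq> p \<Longrightarrow> v \<noteq> q \<Longrightarrow>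
       z \<in> closed_segment u v \<Longrightarrow> z \<in> closed_segment p q \<Longrightarrow> False"
  shows "{p, q} \<in> E"
proof -
  have share: "z = r" if "r \<in> P" "s \<in> P" "v \<in> P" "r \<noteq> s" "r \<noteq> v" "s \<noteq> v"
    "z \<in> closed_segment r s" "z \<in> closed_segment r v" for r s v z
    using segments_with_common_end[OF orientation_nonzero[of r s v] that(7,8)] that(1-6) by simp
  have key: "convex hull e \<inter> convex hull {p, q} \<subseteq> e \<inter> {p, q}" if e: "e \<in> E" "e \<noteq> {p, q}" for e
  proof
    fix z assume z: "z \<in> convex hull e \<inter> convex hull {p, q}"
    then have zpq: "z \<in> closed_segment p q" "z \<in> closed_segment q p"
      by (simp_all add: segment_convex_hull insert_commute)
    have c: "card e = 2" using e(1) by (rule edge_card)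
    consider "p \<in> e" | "q \<in> e" | "p \<notin> e" "q \<notin> e" by blast
    then show "z \<in> e \<inter> {p, q}"
    proof cases
      case 1
      from card_2_pairE[OF c this] obtain v where v: "e = {p, v}" "p \<noteq> v" .
      have "v \<in> P" using e(1) unfolding v(1) by (rule edgeD)
      moreover have "q \<noteq> v" using e(2) v(1) by auto
      moreover have "z \<in> closed_segment p v" using z v(1) by (simp add: segment_convex_hull)
      ultimately have "z = p" using share[of p q v z] pq v(2) zpq by simp
      then show ?thesis using v by simp
    next
      case 2
      from card_2_pairE[OF c this] obtain v where v: "e = {q, v}" "q \<noteq> v" .
      have "v \<in> P" using e(1) unfolding v(1) by (rule edgeD)
      moreover have "p \<noteq> v" using e(2) v(1) by auto
      moreover have "z \<in> closed_segment q v" using z v(1) by (simp add: segment_convex_hull)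
      ultimately have "z = q" using share[of q p v z] pq v(2) zpq by simp
      then show ?thesis using v by simp
    next
      case 3
      obtain u v where "e = {u, v}" using c unfolding card_2_iff by auto
      moreover have "z \<in> closed_segment u v" using z \<open>e = {u, v}\<close> by (simp add: segment_convex_hull)
      ultimately show ?thesis using 3 uncrossed[of u v z] e(1) zpq(1) by auto
    qed
  qed
  have "plane_straight_line_graph P (insert {p, q} E)"
    unfolding plane_straight_line_graph_def
  proof (intro conjI)
    show "simple_graph P (insert {p, q} E)"
      using pq edge_subset edge_card by (auto simp: simple_graph_def)
    have "P \<inter> convex hull {p, q} = {p, q}"
      using segment_Int_P[of p q] pq by (auto simp: segment_convex_hull[symmetric])
    then show "\<forall>e\<in>insert {p, q} E. P \<inter> convex hull e = e"
      using edge_Int_P by simp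
    show "\<forall>e\<in>insert {p, q} E. \<forall>f\<in>insert {p, q} E. e \<noteq> f \<longrightarrow>
        convex hull e \<inter> convex hull f \<subseteq> e \<inter> f"
    proof (intro ballI impI)
      fix e f assume ef: "e \<in> insert {p, q} E" "f \<in> insert {p, q} E" "e \<noteq> f"
      show "convex hull e \<inter> convex hull f \<subseteq> e \<inter> f"
      proof (cases "e = {p, q}")
        case True
        then have "f \<in> E" "f \<noteq> {p, q}" using ef by auto
        from key[OF this] show ?thesis unfolding True by (simp only: Int_commute)
      next
        case e: False
        show ?thesis
        proof (cases "f = {p, q}")
          case True
          then show ?thesis using key[of e] e ef(1) by simp
        next
          case False
          then show ?thesis using edges_Int[of e f] e ef by simp
        qed
      qed
    qed
  qed
  with maximal[of "insert {p, q} E"] have "insert {p, q} E = E" by (simp add: subset_insertI)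
  then show ?thesis by blast
qed

text \<open>4-connectivity in the form used below: along a path avoiding the three points of
  \<open>C\<close>, a property that holds at the start and fails at the end is lost across some
  edge.\<close>

lemma disconnectE:
  assumes "C \<subseteq> P" "card C = 3" "x \<in> P - C" "A x" "y \<in> P - C" "\<not> A y"
  obtains u v where "{u, v} \<in> E" "u \<in> P - C" "v \<in> P - C" "A u" "\<not> A v"
proof -
  let ?R = "{(x, y). x \<in> P - C \<and> y \<in> P - C \<and> {x, y} \<in> {e \<in> E. e \<subseteq> P - C}}"
  have "(x, y) \<in> ?R\<^sup>*"
    using four_conn assms(1-3,5) unfolding four_connected_def graph_connected_def by blast
  then have "\<not> A y \<longrightarrow> (\<exists>u v. (u, v) \<in> ?R \<and> A u \<and> \<not> A v)"
    using assms(4) by (induction rule: rtrancl_induct) blast+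
  then show ?thesis using assms(6) that by blast
qed

text \<open>An edge changing sides of the line \<open>ab\<close> meets it in a point of the hull; as
  \<open>a\<close> and \<open>b\<close> are extreme, that point lies on the edge
  \<open>{a, b}\<close> itself, against planarity. The point \<open>w\<close> fills the separating
  set up to three.\<close>

lemma chord_does_not_separate:
  assumes ab: "{a, b} \<in> E" "a extreme_point_of convex hull P" "b extreme_point_of convex hull P"
    and w: "w \<in> P" "w \<noteq> a" "w \<noteq> b"
    and x: "x \<in> P" "x \<noteq> w" "orientation a b x > 0"
    and y: "y \<in> P" "y \<noteq> w" "orientation a b y < 0"
  shows False
proof -
  note abP = edgeD[OF ab(1)]
  have C: "{a, b, w} \<subseteq> P" "card {a, b, w} = 3" using abP w by auto
  have "x \<in> P - {a, b, w}" "y \<in> P - {a, b, w}" "\<not> orientation a b y > 0" using x y by auto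
  then obtain u v where uv: "{u, v} \<in> E" "u \<in> P - {a, b, w}" "v \<in> P - {a, b, w}"
    "orientation a b u > 0" "\<not> orientation a b v > 0"
    using disconnectE[OF C, of x "\<lambda>x. orientation a b x > 0" y] x(3) by blast
  obtain t where t: "0 \<le> t" "t \<le> 1"
    "(1 - t) * orientation a b u + t * orientation a b v = 0"
    using affine_first_zero[of "orientation a b u" "orientation a b v"] uv(4,5) by auto
  define z where "z = (1 - t) *\<^sub>R u + t *\<^sub>R v"
  have z: "z \<in> closed_segment u v" "orientation a b z = 0"
    using t by (auto simp: z_def in_segment orientation_convex_combination)
  then have zH: "z \<in> convex hull P"
    using uv(2,3) by (meson DiffD1 closed_segment_subset convex_convex_hull hull_inc subsetD)
  obtain l where l: "z = a + l *\<^sub>R (b - a)" using z abP orientation_zeroE by blast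
  have H: "a \<in> convex hull P" "b \<in> convex hull P" using abP by (auto intro: hull_inc)
  have "l \<le> 1" using extreme_not_beyond[OF ab(3) H(1)] zH l abP by blast
  moreover have "z = b + (1 - l) *\<^sub>R (a - b)" using l by (simp add: algebra_simps)
  then have "1 - l \<le> 1" using extreme_not_beyond[OF ab(2) H(2), of "1 - l"] zH abP by metis
  ultimately have "z \<in> closed_segment a b" using l in_closed_segment_ray by simp
  then show False using edges_cross[OF uv(1) ab(1) _ z(1)] uv(2,3) by auto
qed

text \<open>The rays from \<open>a\<close> through \<open>b\<close> and \<open>s\<close> span a
  convex cone. An edge leaving it meets one of the rays inside the hull, hence one of the edges
  \<open>{a, b}\<close>, \<open>{a, s}\<close>, as \<open>b\<close> and \<open>s\<close> are
  extreme. So removing \<open>a\<close>, \<open>b\<close>, \<open>s\<close> would cut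
  \<open>x\<close> off from any point outside the open cone.\<close>

lemma cone_does_not_separate:
  assumes ab: "{a, b} \<in> E" "b extreme_point_of convex hull P"
    and as: "{a, s} \<in> E" "s extreme_point_of convex hull P"
    and pos: "orientation a b s > 0"
    and x: "x \<in> P" "orientation a b x > 0" "orientation a x s > 0"
    and y: "y \<in> P" "y \<noteq> a" "y \<noteq> b" "y \<noteq> s"
  shows "orientation a b y > 0 \<and> orientation a y s > 0"
proof (rule ccontr)
  assume ny: "\<not> ?thesis"
  note P = edgeD[OF ab(1)] edgeD[OF as(1)]
  have "b \<noteq> s" using pos by auto
  then have C: "{a, b, s} \<subseteq> P" "card {a, b, s} = 3" using P by auto
  have "x \<in> P - {a, b, s}" "y \<in> P - {a, b, s}" using x y by auto
  then obtain u v where uv: "{u, v} \<in> E" "u \<in> P - {a, b, s}" "v \<in> P - {a, b, s}"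
    "orientation a b u > 0 \<and> orientation a u s > 0" "\<not> (orientation a b v > 0 \<and> orientation a v s > 0)"
    using disconnectE[OF C, of x "\<lambda>x. orientation a b x > 0 \<and> orientation a x s > 0" y] x ny by blast
  \<comment> \<open>In this form both cone conditions are affine in the last argument, as the exit
    argument requires.\<close>
  have sw: "orientation a w s = orientation s a w" for w by (simp add: orientation_def algebra_simps)
  have "orientation a b u \<ge> 0" "orientation s a u \<ge> 0" "orientation a b v \<le> 0 \<or> orientation s a v \<le> 0"
    using uv(4,5) unfolding sw by auto
  from affine_pair_first_zero[OF this]
obtain t where t: "0 \<le> t" "t \<le> 1" "(1 - t) * orientation a b u + t * orientation a b v \<ge> 0"
    "(1 - t) * orientation s a u + t * orientation s a v \<ge> 0"
    "(1 - t) * orientation a b u + t * orientation a b v = 0 \<or>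
     (1 - t) * orientation s a u + t * orientation s a v = 0" by blast
  define z where "z = (1 - t) *\<^sub>R u + t *\<^sub>R v"
  have z: "z \<in> closed_segment u v" "orientation a b z \<ge> 0" "orientation a z s \<ge> 0"
    "orientation a b z = 0 \<or> orientation a s z = 0"
    using t sw orientation_swap[of a s z] by (auto simp: z_def in_segment orientation_convex_combination)
  then have zH: "z \<in> convex hull P"
    using uv(2,3) by (meson DiffD1 closed_segment_subset convex_convex_hull hull_inc subsetD)
  have aH: "a \<in> convex hull P" using P by (auto intro: hull_inc)
  from z(4) show False
  proof
    assume "orientation a b z = 0"
    then obtain l where l: "z = a + l *\<^sub>R (b - a)" using P orientation_zeroE by blast
    have "l \<le> 1" using extreme_not_beyond[OF ab(2) aH] zH l P by blast
    \<comment> \<open>The other cone condition, still valid at the exit point, puts \<open>z\<close>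
      on the ray towards \<open>b\<close> and not on its backward extension.\<close>
    moreover have "orientation a z s = l * orientation a b s"
      by (simp add: l orientation_def algebra_simps)
    then have "l \<ge> 0" using z(3) pos by (simp add: zero_le_mult_iff)
    ultimately have "z \<in> closed_segment a b" using l in_closed_segment_ray by simp
    then show False using edges_cross[OF uv(1) ab(1) _ z(1)] uv(2,3) by auto
  next
    assume "orientation a s z = 0"
    then obtain l where l: "z = a + l *\<^sub>R (s - a)" using P orientation_zeroE by blast
    have "l \<le> 1" using extreme_not_beyond[OF as(2) aH] zH l P by blast
    moreover have "orientation a b z = l * orientation a b s"
      by (simp add: l orientation_def algebra_simps)
    then have "l \<ge> 0" using z(2) pos by (simp add: zero_le_mult_iff)
    ultimately have "z \<in> closed_segment a s" using l in_closed_segment_ray by simp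
    then show False using edges_cross[OF uv(1) as(1) _ z(1)] uv(2,3) by auto
  qed
qed

end

section \<open>Faces of a maximal plane graph\<close>

lemma orientation_linear:
  "orientation a d (a + r *\<^sub>R (x - a) + s *\<^sub>R (u - a)) = r * orientation a d x + s * orientation a d u"
  by (simp add: orientation_def algebra_simps)

lemma orientation_of_coordinates:
  "orientation a (a + r *\<^sub>R (x - a) + s *\<^sub>R (u - a)) (a + r' *\<^sub>R (x - a) + s' *\<^sub>R (u - a))
   = (r * s' - s * r') * orientation a x u"
  by (simp add: orientation_def algebra_simps)

text \<open>With \<open>g\<close> the inner product with \<open>c - b\<close>, the ratio
  \<open>g y / orientation b c y\<close> is the cotangent of the angle at \<open>b\<close> from
  \<open>c\<close> to \<open>y\<close>. It is monotone on the open half-plane, so extremal ratios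
  give extremal directions.\<close>

lemma angular_extrema:
  assumes "finite N" "N \<noteq> {}" "\<And>y. y \<in> N \<Longrightarrow> orientation b c y > 0"
  shows angular_min: "\<exists>a\<in>N. \<forall>y\<in>N. orientation b a y \<ge> 0"
    and angular_max: "\<exists>a\<in>N. \<forall>y\<in>N. orientation b a y \<le> 0"
proof -
  define g where "g y = ((y::real^2)$1 - b$1) * (c$1 - b$1) + (y$2 - b$2) * (c$2 - b$2)" for y
  define q where "q = (c$1 - b$1)^2 + (c$2 - b$2)^2"
  \<comment> \<open>For \<open>p = c - b\<close>, and \<open>a\<close>, \<open>y\<close> taken
    relative to \<open>b\<close>, this is the identity of inner and cross products
    \<open>|p|^2 (a x y) = (p.a)(p x y) - (p x a)(p.y)\<close>.\<close>
  have id: "q * orientation b a y = g a * orientation b c y - orientation b c a * g y" for a y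
    by (simp add: q_def g_def orientation_def power2_eq_square algebra_simps)
  obtain y0 where "y0 \<in> N" using assms(2) by blast
  then have "b \<noteq> c" using assms(3)[of y0] by auto
  then have "c$1 - b$1 \<noteq> 0 \<or> c$2 - b$2 \<noteq> 0" by (auto simp: vec_eq_iff forall_2)
  then have q: "q > 0" unfolding q_def by (auto simp: sum_power2_gt_zero_iff)
  obtain a where a: "a \<in> N" "\<And>y. y \<in> N \<Longrightarrow> - g a * orientation b c y \<le> - g y * orientation b c a"
    using finite_min_ratio[OF assms, of "\<lambda>y. y" "\<lambda>y. - g y"] by auto
  have "q * orientation b a y \<ge> 0" if "y \<in> N" for y
    using a(2)[OF that] by (simp add: id mult.commute)
  then show "\<exists>a\<in>N. \<forall>y\<in>N. orientation b a y \<ge> 0"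
    using a(1) q by (auto simp: zero_le_mult_iff)
  obtain a where a: "a \<in> N" "\<And>y. y \<in> N \<Longrightarrow> g a * orientation b c y \<le> g y * orientation b c a"
    using finite_min_ratio[OF assms, of "\<lambda>y. y" g] by auto
  have "q * orientation b a y \<le> 0" if "y \<in> N" for y
    using a(2)[OF that] by (simp add: id mult.commute)
  then show "\<exists>a\<in>N. \<forall>y\<in>N. orientation b a y \<le> 0"
    using a(1) q by (auto simp: mult_le_0_iff)
qed

lemma closed_segmentE:
  assumes "z \<in> closed_segment p q"
  obtains t where "0 \<le> t" "t \<le> 1" "z = (1 - t) *\<^sub>R p + t *\<^sub>R q"
  using assms by (auto simp: in_segment)

lemma convex_combination_pos:
  fixes p q :: real
  assumes "0 \<le> t" "t \<le> 1" "p > 0" "q > 0"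
  shows "(1 - t) * p + t * q > 0"
proof (cases "t = 0")
  case False
  then have "t * q > 0" "(1 - t) * p \<ge> 0" using assms by auto
  then show ?thesis by linarith
qed (use assms in simp)

lemma convex_combination_neg_cases:
  fixes p q :: real
  assumes "0 \<le> t" "t \<le> 1" "(1 - t) * p + t * q < 0"
  shows "p < 0 \<or> q < 0"
proof (rule ccontr)
  assume "\<not> ?thesis"
  then have "(1 - t) * p \<ge> 0" "t * q \<ge> 0" using assms by auto
  then show False using assms by linarith
qed

context maximal_plane_graph
begin

lemma finite_E: "finite E"
  using finite_subset[of E "Pow P"] edge_subset finite_P by auto

lemma card_P: "card P \<ge> 5"
  using four_conn by (simp add: four_connected_def)

lemma fifth_point:
  obtains y where "y \<in> P" "y \<noteq> a" "y \<noteq> b" "y \<noteq> c" "y \<noteq> d"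
proof -
  have "card {a, b, c, d} < card P"
    using card_P card_insert_le_m1[of 4 "{b,c,d}" a] card_insert_le_m1[of 3 "{c,d}" b]
      card_insert_le_m1[of 2 "{d}" c] by simp
  then have "\<not> P \<subseteq> {a, b, c, d}" using card_mono[of "{a, b, c, d}" P] by auto
  then show ?thesis using that by blast
qed

lemma crossing_edgeE:
  assumes "p \<in> P" "q \<in> P" "p \<noteq> q" "{p, q} \<notin> E"
  obtains u v z where "{u, v} \<in> E" "u \<noteq> p" "u \<noteq> q" "v \<noteq> p" "v \<noteq> q"
    "z \<in> closed_segment u v" "z \<in> closed_segment p q"
  using edge_if_uncrossed[OF assms(1-3)] assms(4) by blast

text \<open>Otherwise the segment from \<open>a\<close> to \<open>s\<^sub>0\<close> is crossed by an edge; let \<open>x\<close> be the crossing point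
  nearest to \<open>a\<close>. In the triangle spanned by \<open>a\<close>, \<open>x\<close> and an end \<open>u\<close> of that edge, the point
  of \<open>P\<close> that comes first in angular order from \<open>x\<close> is visible from \<open>a\<close>.\<close>

lemma neighbour_in_half_plane:
  assumes aP: "a \<in> P" and sP: "s0 \<in> P" and fs: "orientation a d s0 < 0"
  shows "\<exists>y. {a, y} \<in> E \<and> orientation a d y < 0"
proof (rule ccontr)
  assume none: "\<not> ?thesis"
  have as: "a \<noteq> s0" using fs by auto
  \<comment> \<open>Edges at \<open>a\<close> are left out because they would make \<open>a\<close>
    itself the nearest crossing, those at \<open>s0\<close> because they meet the segment only
    there. \<open>X\<close> is a finite union of closed sets, so a nearest crossing exists.\<close>
  define G where "G = {g \<in> E. a \<notin> g \<and> s0 \<notin> g}"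
  define X where "X = (\<Union>g\<in>G. closed_segment a s0 \<inter> convex hull g)"
  have XI: "z \<in> X" if "{p, q} \<in> E" "a \<noteq> p" "a \<noteq> q" "s0 \<noteq> p" "s0 \<noteq> q" "z \<in> closed_segment p q"
    "z \<in> closed_segment a s0" for p q z
  proof -
    have "{p, q} \<in> G" using that by (simp add: G_def)
    then show ?thesis unfolding X_def using that(6,7) by (auto simp: segment_convex_hull)
  qed
  have "{a, s0} \<notin> E" using none fs by blast
  then obtain p q z where "{p, q} \<in> E" "p \<noteq> a" "p \<noteq> s0" "q \<noteq> a" "q \<noteq> s0"
    "z \<in> closed_segment p q" "z \<in> closed_segment a s0"
    by (rule crossing_edgeE[OF aP sP as]) blast
  then have "X \<noteq> {}" using XI[of p q z] by auto
  moreover have "closed X"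
  proof -
    have "closed (convex hull g)" if "g \<in> G" for g
    proof -
      have "finite g" using that edge_subset[of g] finite_P by (auto simp: G_def intro: finite_subset)
      then show ?thesis by (simp add: compact_imp_closed finite_imp_compact_convex_hull)
    qed
    moreover have "finite G" using finite_E by (simp add: G_def)
    ultimately show ?thesis unfolding X_def by (intro closed_UN) auto
  qed
  ultimately obtain x where xX: "x \<in> X" and nearest: "\<And>y. y \<in> X \<Longrightarrow> dist a x \<le> dist a y"
    using distance_attains_inf[of X a] by metis
  obtain g where g: "g \<in> E" "a \<notin> g" "s0 \<notin> g" "x \<in> closed_segment a s0" "x \<in> convex hull g"
    using xX by (auto simp: X_def G_def)
  obtain p q where pq: "g = {p, q}" using edge_card[OF g(1)] unfolding card_2_iff by auto
  have xpq: "x \<in> closed_segment p q" using g(5) pq by (simp add: segment_convex_hull)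
  have pqP: "p \<in> P" "q \<in> P" using g(1) pq edgeD[of p q] by auto
  have xa: "x \<noteq> a" using segment_Int_P[OF pqP aP] xpq g(2) pq by auto
  have xs: "x \<noteq> s0" using segment_Int_P[OF pqP sP] xpq g(3) pq by auto
  have xnP: "x \<notin> P" using segment_Int_P[OF aP sP _ g(4)] xa xs by blast
  obtain l where l0: "0 \<le> l" "l \<le> 1" "x = (1 - l) *\<^sub>R a + l *\<^sub>R s0" using closed_segmentE[OF g(4)] .
  have l: "0 < l" "l < 1" "x = a + l *\<^sub>R (s0 - a)"
    using l0 xa xs by (auto simp: algebra_simps order_le_less)
  have fx: "orientation a d x < 0"
  proof -
    have "orientation a d x = l * orientation a d s0" by (simp add: l(3) orientation_def algebra_simps)
    then show ?thesis using fs l by (simp add: mult_pos_neg)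
  qed
  obtain r where r: "0 \<le> r" "r \<le> 1" "x = (1 - r) *\<^sub>R p + r *\<^sub>R q" using closed_segmentE[OF xpq] .
  \<comment> \<open>Since \<open>x\<close> is on the negative side, so is one end \<open>u\<close>.
    Then the whole triangle \<open>a x u\<close> except \<open>a\<close> is on that side, and any
    neighbour of \<open>a\<close> in it is a contradiction.\<close>
  have "orientation a d p < 0 \<or> orientation a d q < 0"
    using fx convex_combination_neg_cases[OF r(1,2)] by (simp add: r(3) orientation_convex_combination)
  then obtain u v where uv: "g = {u, v}" "orientation a d u < 0"
    using pq by blast
  have uvE: "{u, v} \<in> E" using g(1) uv by simp
  note uvP = edgeD[OF uvE]
  have uvn: "u \<noteq> a" "u \<noteq> s0" "v \<noteq> a" "v \<noteq> s0" using uv(1) g(2,3) by auto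
  have xuv: "x \<in> closed_segment u v" using g(5) uv by (simp add: segment_convex_hull)
  define D where "D = orientation a x u"
  have "D = l * orientation a s0 u" unfolding D_def l(3) by (simp add: orientation_def algebra_simps)
  moreover have "orientation a s0 u \<noteq> 0" using orientation_nonzero[OF aP sP uvP(1)] as uvn by auto
  ultimately have D: "D \<noteq> 0" using l by simp
  \<comment> \<open>Coordinates with \<open>a = (0, 0)\<close>, \<open>x = (1, 0)\<close>,
    \<open>u = (0, 1)\<close>: the triangle is \<open>A >= 0\<close>, \<open>B >= 0\<close>,
    \<open>A + B <= 1\<close>, and the edge \<open>{u, v}\<close> lies on
    \<open>A + B = 1\<close>.\<close>
  define A where "A w = orientation a w u / D" for w
  define B where "B w = orientation a x w / D" for w
  have coord: "w = a + A w *\<^sub>R (x - a) + B w *\<^sub>R (u - a)" for w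
    using orientation_coordinates[of a x u w] D unfolding A_def B_def D_def by simp
  have B_comb: "B ((1 - t) *\<^sub>R w + t *\<^sub>R w') = (1 - t) * B w + t * B w'" for t w w'
    by (simp add: B_def orientation_convex_combination add_divide_distrib)
  have A_comb: "A ((1 - t) *\<^sub>R w + t *\<^sub>R w') = (1 - t) * A w + t * A w'" for t w w'
    unfolding A_def orientation_rotate[of a _ u] orientation_rotate[of _ u a]
    by (simp add: orientation_convex_combination add_divide_distrib)
  have vals: "A a = 0" "B a = 0" "A x = 1" "B x = 0" "A u = 0" "B u = 1"
    using D by (simp_all add: A_def B_def D_def)
  have or: "orientation a y w = (A y * B w - B y * A w) * D" for y w
    using orientation_of_coordinates[of a "A y" x "B y" u "A w" "B w"] coord[of y] coord[of w]
    unfolding D_def by simp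
  have on_uv: "A w + B w = 1" if wuv: "w \<in> closed_segment u v" for w
  proof -
    obtain r where r: "0 \<le> r" "r \<le> 1" "x = (1 - r) *\<^sub>R u + r *\<^sub>R v" using closed_segmentE[OF xuv] .
    have "r \<noteq> 0" using r(3) uvP xnP by auto
    have "A x + B x = (1 - r) * (A u + B u) + r * (A v + B v)"
      unfolding r(3) A_comb B_comb by (simp add: algebra_simps)
    then have "r * (A v + B v) = r" by (simp add: vals)
    then have v1: "A v + B v = 1" using \<open>r \<noteq> 0\<close> by simp
    obtain t where t: "0 \<le> t" "t \<le> 1" "w = (1 - t) *\<^sub>R u + t *\<^sub>R v" using closed_segmentE[OF wuv] .
    have "A w + B w = (1 - t) * (A u + B u) + t * (A v + B v)"
      unfolding t(3) A_comb B_comb by (simp add: algebra_simps)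
    then show ?thesis by (simp add: vals v1)
  qed
  define Q where "Q = {y \<in> P. y \<noteq> a \<and> A y \<ge> 0 \<and> B y \<ge> 0 \<and> A y + B y \<le> 1}"
  have "u \<in> Q" using uvP uvn by (simp add: Q_def vals)
  have Qpos: "A y + B y > 0" if "y \<in> Q" for y
  proof (rule ccontr)
    assume "\<not> A y + B y > 0"
    then have "A y = 0" "B y = 0" using that by (auto simp: Q_def)
    then show False using coord[of y] that by (simp add: Q_def)
  qed
  \<comment> \<open>On the quadrant, \<open>B / (A + B)\<close> grows with the angle from the ray
    \<open>ax\<close>, so \<open>y\<close> is nearest to that ray in direction.\<close>
  obtain y where yQ: "y \<in> Q" and ymin: "\<And>y'. y' \<in> Q \<Longrightarrow> B y * (A y' + B y') \<le> B y' * (A y + B y)"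
  proof (rule finite_min_ratio[of Q "\<lambda>y. A y + B y" B])
    show "finite Q" using finite_P by (simp add: Q_def)
    show "Q \<noteq> {}" using \<open>u \<in> Q\<close> by auto
  qed (use Qpos in auto)
  have y: "y \<in> P" "y \<noteq> a" "A y \<ge> 0" "B y \<ge> 0" "A y + B y \<le> 1" using yQ by (auto simp: Q_def)
  have "orientation a d y = A y * orientation a d x + B y * orientation a d u"
    using orientation_linear[of a d "A y" x "B y" u] coord[of y] by simp
  moreover have "A y > 0 \<or> B y > 0" using Qpos[OF yQ] y(3,4) by linarith
  then have "A y * orientation a d x + B y * orientation a d u < 0"
  proof
    assume "A y > 0"
    then have "A y * orientation a d x < 0" using fx by (simp add: mult_pos_neg)
    moreover have "B y * orientation a d u \<le> 0" using y(4) uv(2) by (simp add: mult_nonneg_nonpos)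
    ultimately show ?thesis by linarith
  next
    assume "B y > 0"
    then have "B y * orientation a d u < 0" using uv(2) by (simp add: mult_pos_neg)
    moreover have "A y * orientation a d x \<le> 0" using y(3) fx by (simp add: mult_nonneg_nonpos)
    ultimately show ?thesis by linarith
  qed
  ultimately have "{a, y} \<notin> E" using none by auto
  then obtain g1 g2 z where g12: "{g1, g2} \<in> E" "g1 \<noteq> a" "g1 \<noteq> y" "g2 \<noteq> a" "g2 \<noteq> y"
    "z \<in> closed_segment g1 g2" "z \<in> closed_segment a y"
    by (rule crossing_edgeE[OF aP y(1) y(2)[symmetric]]) blast
  note gP = edgeD[OF g12(1)]
  have za: "z \<noteq> a" using segment_Int_P[OF gP(1,2) aP] g12 by auto
  have zy: "z \<noteq> y" using segment_Int_P[OF gP(1,2) y(1)] g12 by auto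
  obtain tau where tau0: "0 \<le> tau" "tau \<le> 1" "z = (1 - tau) *\<^sub>R a + tau *\<^sub>R y"
    using closed_segmentE[OF g12(7)] .
  have tau: "0 < tau" "tau < 1" using tau0 za zy by (auto simp: order_le_less)
  have Az: "A z = tau * A y" "B z = tau * B y" by (simp_all add: tau0(3) A_comb B_comb vals)
  have Cz: "A z + B z < 1"
  proof -
    have "A z + B z = tau * (A y + B y)" by (simp add: Az algebra_simps)
    also have "\<dots> \<le> tau * 1" using y(5) tau by (intro mult_left_mono) auto
    finally show ?thesis using tau by simp
  qed
  \<comment> \<open>\<open>K w\<close> is \<open>orientation a y w / D\<close>. It vanishes on the
    line \<open>ay\<close>, and the minimality of \<open>y\<close> says that it is nonnegative on
    \<open>Q\<close>.\<close>
  define K where "K w = A y * B w - B y * A w" for w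
  have K_comb: "K ((1 - t) *\<^sub>R w + t *\<^sub>R w') = (1 - t) * K w + t * K w'" for t w w'
    unfolding K_def A_comb B_comb by (simp add: algebra_simps)
  have Kz: "K z = 0" by (simp add: K_def Az)
  have Knz: "K w \<noteq> 0" if "w \<in> P" "w \<noteq> a" "w \<noteq> y" for w
    using or[of y w] orientation_nonzero[OF aP y(1) that(1)] that y(2) unfolding K_def by auto
  have "\<exists>h h'. {h, h'} = {g1, g2} \<and> K h < 0"
  proof (rule ccontr)
    assume n: "\<not> ?thesis"
    then have "\<not> K g1 < 0" "\<not> K g2 < 0" by (auto simp: insert_commute)
    then have "K g1 > 0" "K g2 > 0" using Knz[of g1] Knz[of g2] gP g12 by auto
    moreover obtain t where "0 \<le> t" "t \<le> 1" "z = (1 - t) *\<^sub>R g1 + t *\<^sub>R g2"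
      using closed_segmentE[OF g12(6)] .
    ultimately have "K z > 0" using convex_combination_pos by (simp add: K_comb)
    then show False using Kz by simp
  qed
  then obtain h h' where h: "{h, h'} = {g1, g2}" "K h < 0" by blast
  have hE: "{h, h'} \<in> E" using h g12 by simp
  have hn: "h \<noteq> a" "h' \<noteq> a" using h(1) g12 by (auto simp: doubleton_eq_iff)
  note hP = edgeD[OF hE]
  have zh: "z \<in> closed_segment h h'"
    using g12(6) h(1) by (simp add: segment_convex_hull)
  have "h \<notin> Q"
  proof
    assume "h \<in> Q"
    from ymin[OF this] h(2) show False by (simp add: K_def algebra_simps)
  qed
  \<comment> \<open>If \<open>B y = 0\<close>, then \<open>y\<close> is on the line
    \<open>a s0\<close>, so \<open>y = s0\<close>; but \<open>s0\<close> has first coordinate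
    \<open>1 / l > 1\<close>.\<close>
  have By: "B y > 0"
  proof (rule ccontr)
    assume "\<not> B y > 0"
    then have "y = a + A y *\<^sub>R (x - a)" using y(4) coord[of y] by simp
    then have yl: "y = a + (A y * l) *\<^sub>R (s0 - a)" using l(3) by simp
    then have "orientation a s0 y = 0" by (metis orientation_on_line)
    then have "y = s0" using orientation_nonzero[OF aP sP y(1) as] y(2) by auto
    then have "(1 - A y * l) *\<^sub>R (s0 - a) = 0" using yl by (simp add: algebra_simps)
    then have "A y * l = 1" using as by simp
    moreover have "A y * l \<le> l" using y l by (simp add: mult_le_cancel_right1)
    ultimately show False using l by simp
  qed
  \<comment> \<open>As \<open>K h < 0\<close>, the end \<open>h\<close> is on the side of
    \<open>x\<close> but not in \<open>Q\<close>, so it lies beyond \<open>ax\<close> or beyond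
    \<open>xu\<close>. The point \<open>w\<close> below is where the crossing edge, followed from
    \<open>z\<close> to \<open>h\<close>, leaves through one of these sides.\<close>
  have "B h < 0 \<or> 1 - (A h + B h) < 0"
  proof (rule ccontr)
    assume n: "\<not> ?thesis"
    then have "A y * B h \<ge> 0" using y by simp
    then have "B y * A h > 0" using h(2) by (simp add: K_def)
    then have "A h > 0" using By by (simp add: zero_less_mult_iff)
    then show False using n \<open>h \<notin> Q\<close> hP hn by (auto simp: Q_def)
  qed
  then obtain t where t: "0 \<le> t" "t \<le> 1" "(1 - t) * B z + t * B h \<ge> 0"
    "(1 - t) * (1 - (A z + B z)) + t * (1 - (A h + B h)) \<ge> 0"
    "(1 - t) * B z + t * B h = 0 \<or> (1 - t) * (1 - (A z + B z)) + t * (1 - (A h + B h)) = 0"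
    using affine_pair_first_zero[of "B z" "1 - (A z + B z)" "B h" "1 - (A h + B h)"] Cz By tau
    unfolding Az(2) by auto
  define w where "w = (1 - t) *\<^sub>R z + t *\<^sub>R h"
  have w: "B w \<ge> 0" "A w + B w \<le> 1" "B w = 0 \<or> A w + B w = 1"
    unfolding w_def A_comb B_comb using t by (auto simp: algebra_simps)
  have Kw: "K w = t * K h" by (simp add: w_def K_comb Kz)
  have "w \<in> closed_segment z h" using t unfolding w_def in_segment by blast
  then have wh: "w \<in> closed_segment h h'"
    using zh subset_closed_segment[of z h h h'] by auto
  have other: "{h, h'} \<noteq> {u, v}"
  proof
    assume "{h, h'} = {u, v}"
    then have "z \<in> closed_segment u v" using zh by (simp add: segment_convex_hull)
    then show False using on_uv Cz by fastforce
  qed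
  from w(3) show False
  proof
    \<comment> \<open>Exit through \<open>ax\<close>: \<open>w\<close> is a crossing at least as
      near as \<open>x\<close>, so \<open>w = x\<close>, and two distinct edges meet outside
      \<open>P\<close>. An edge ending in \<open>s0\<close> does not count as a crossing; it is
      excluded by general position.\<close>
    assume Bw: "B w = 0"
    have "K w \<le> 0" using Kw t(1) h(2) by (simp add: mult_nonneg_nonpos)
    then have "A w \<ge> 0" using Bw By by (simp add: K_def zero_le_mult_iff)
    moreover have "A w \<le> 1" using w(2) Bw by simp
    moreover have wx: "w = a + A w *\<^sub>R (x - a)" using coord[of w] Bw by simp
    ultimately have "w \<in> closed_segment a x" using in_closed_segment_ray[of "A w" a x] by simp
    then have was: "w \<in> closed_segment a s0" using g(4) subset_closed_segment[of a x a s0] by auto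
    have wl: "w = a + (A w * l) *\<^sub>R (s0 - a)" using wx l(3) by simp
    have "A w * l < 1"
    proof -
      have "A w * l \<le> 1 * l" using \<open>A w \<le> 1\<close> l by (intro mult_right_mono) auto
      then show ?thesis using l by linarith
    qed
    then have ws: "w \<noteq> s0"
    proof -
      have "s0 - w = (1 - A w * l) *\<^sub>R (s0 - a)" by (subst wl) (simp add: algebra_simps)
      then show ?thesis using \<open>A w * l < 1\<close> as by auto
    qed
    consider "s0 = h" | "s0 = h'" | "s0 \<noteq> h" "s0 \<noteq> h'" by blast
    then show False
    proof cases
      case 1
      have "w = s0"
        using segments_with_common_end[of s0 a h' w] orientation_nonzero[OF sP aP hP(2)] was wh 1 hn as hP
        by (auto simp: closed_segment_commute)
      then show False using ws by simp
    next
      case 2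
      have "w = s0"
        using segments_with_common_end[of s0 a h w] orientation_nonzero[OF sP aP hP(1)] was wh 2 hn as hP
        by (auto simp: closed_segment_commute)
      then show False using ws by simp
    next
      case 3
      then have "w \<in> X" using XI[OF hE _ _ _ _ wh was] hn by auto
      then have "dist a x \<le> dist a w" by (rule nearest)
      also have "dist a w = A w * dist a x"
        using \<open>A w \<ge> 0\<close> by (subst wx) (simp add: dist_norm norm_minus_commute)
      finally have "A w \<ge> 1" using xa by (simp add: mult_le_cancel_right1)
      then have "w = x" using \<open>A w \<le> 1\<close> wx by simp
      then show False using edges_cross[OF hE uvE other wh] xuv xnP uvP by auto
    qed
  next
    \<comment> \<open>Exit through \<open>xu\<close>: the crossing edge meets \<open>{u, v}\<close>,
      so \<open>w\<close> is a common end. \<open>w = u\<close> contradicts \<open>K w < 0\<close>,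
      and \<open>w = v\<close> would put \<open>x\<close> into \<open>P\<close>.\<close>
    assume ABw: "A w + B w = 1"
    have "t \<noteq> 0" using ABw Cz by (auto simp: w_def)
    then have Kw0: "K w < 0" using Kw t(1) h(2) by (simp add: mult_pos_neg)
    have "A y * B w \<ge> 0" using y w by simp
    then have "B y * A w > 0" using Kw0 by (simp add: K_def)
    then have Aw: "A w > 0" using By by (simp add: zero_less_mult_iff)
    have "w = x + B w *\<^sub>R (u - x)"
    proof -
      have e: "A w = 1 - B w" using ABw by simp
      have "w = a + (1 - B w) *\<^sub>R (x - a) + B w *\<^sub>R (u - a)" using coord[of w] unfolding e .
      then show ?thesis by (simp add: algebra_simps)
    qed
    then have wxu: "w \<in> closed_segment x u"
      using in_closed_segment_ray[of "B w" x u] w(1) Aw ABw by simp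
    have sub: "closed_segment x u \<subseteq> closed_segment u v" using xuv by (simp add: subset_closed_segment)
    then have "w \<in> {u, v}" using edges_cross[OF hE uvE other wh] wxu by auto
    then consider "w = u" | "w = v" by blast
    then show False
    proof cases
      case 1 then show False using Kw0 y by (simp add: K_def vals)
    next
      case 2
      then have "closed_segment u v \<subseteq> closed_segment x u"
        using wxu by (simp add: subset_closed_segment)
      then have "closed_segment x u = closed_segment u v" using sub by auto
      then have "x \<in> {u, v}" unfolding closed_segment_eq by auto
      then show False using xnP uvP by auto
    qed
  qed
qed

end

section \<open>Hull neighbours of an apex, and the face over a hull edge\<close>

context maximal_plane_graph
begin

text \<open>The bound of five vertices matters here: besides \<open>a\<close>, \<open>b\<close>,
  \<open>c\<close>, \<open>y\<close> there is a point to remove together with \<open>a\<close> and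
  \<open>b\<close>, and \<open>c\<close> and \<open>y\<close> would be left on different sides of
  the chord.\<close>

lemma extremes_orientation_sign:
  assumes "{a, b} \<in> E" "a extreme_point_of convex hull P" "b extreme_point_of convex hull P"
    and c: "c \<in> P" "orientation a b c > 0"
    and y: "y \<in> P" "y \<noteq> a" "y \<noteq> b" "y \<noteq> c"
  shows "orientation a b y > 0"
proof (rule ccontr)
  assume n: "\<not> ?thesis"
  note ab = edgeD[OF assms(1)]
  have "orientation a b y \<noteq> 0" using orientation_nonzero[OF ab(1,2) y(1)] ab(3) y by auto
  then have neg: "orientation a b y < 0" using n by simp
  obtain w where w: "w \<in> P" "w \<noteq> a" "w \<noteq> b" "w \<noteq> c" "w \<noteq> y" by (rule fifth_point)
  show False
    by (rule chord_does_not_separate[OF assms(1-3) w(1-3) c(1) w(4)[symmetric] c(2) y(1) w(5)[symmetric] neg])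
qed

text \<open>A third hull neighbour \<open>s\<close> gives three rays from \<open>a\<close>. Any two
  at an angle below 180 degrees bound a cone that contains either none or all of the remaining
  points, and the cone of \<open>b\<close> and \<open>c\<close> is known to be empty.\<close>

lemma hull_neighbours_of_apex:
  assumes E: "{a, b} \<in> E" "{a, c} \<in> E" "{a, s} \<in> E"
    and ext: "b extreme_point_of convex hull P" "c extreme_point_of convex hull P"
      "s extreme_point_of convex hull P"
    and pos: "orientation a b c > 0"
    and empty: "\<And>y. y \<in> P \<Longrightarrow> \<not> (orientation a b y > 0 \<and> orientation a y c > 0)"
  shows "s = b \<or> s = c"
proof (rule ccontr)
  assume n: "\<not> ?thesis"
  note ab = edgeD[OF E(1)] and ac = edgeD[OF E(2)] and as = edgeD[OF E(3)]
  have bc: "b \<noteq> c" using pos by auto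
  obtain y where y: "y \<in> P" "y \<noteq> a" "y \<noteq> b" "y \<noteq> c" "y \<noteq> s" by (rule fifth_point)
  have bs: "b \<noteq> s" using n by auto
  have nz: "orientation a b s \<noteq> 0" "orientation a s c \<noteq> 0" "orientation a b y \<noteq> 0"
    "orientation a y c \<noteq> 0" "orientation a s y \<noteq> 0"
    using orientation_nonzero[of a b s] orientation_nonzero[of a s c] orientation_nonzero[of a b y]
      orientation_nonzero[of a y c] orientation_nonzero[of a s y] ab ac as n bs y by simp_all
  have swap: "orientation a s b = - orientation a b s" "orientation a c s = - orientation a s c"
    "orientation a c y = - orientation a y c" "orientation a y s = - orientation a s y"
    "orientation a c b = - orientation a b c" "orientation a y b = - orientation a b y"
    by (rule orientation_swap)+
  note es = empty[OF as(2)] and ey = empty[OF y(1)]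
  consider "orientation a b s > 0" "orientation a s c < 0"
    | "orientation a b s < 0" "orientation a s c > 0"
    | "orientation a b s < 0" "orientation a s c < 0"
    using es nz(1,2) by argo
  then show False
  proof cases
    \<comment> \<open>\<open>c\<close> lies in the cone of \<open>b\<close> and \<open>s\<close>,
      hence so does \<open>y\<close>. As the cone of \<open>b\<close> and \<open>c\<close> is empty,
      \<open>y\<close> lies between \<open>c\<close> and \<open>s\<close>, which forces
      \<open>b\<close> in there too. Case 2 is the mirror image.\<close>
    case 1
    have cs: "orientation a c s > 0" using 1(2) swap by auto
    have h: "orientation a b y > 0 \<and> orientation a y s > 0"
      by (rule cone_does_not_separate[OF E(1) ext(1) E(3) ext(3) 1(1) ac(2) pos cs y(1,2,3,5)])
    then have "orientation a c y > 0" using ey nz(4) swap by auto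
    then have "orientation a c b > 0"
      using cone_does_not_separate[OF E(2) ext(2) E(3) ext(3) cs y(1) _ _ ab(2) ab(3)[symmetric] bc] h n
      by auto
    then show False using pos swap by simp
  next
    case 2
    have sb: "orientation a s b > 0" using 2(1) swap by auto
    have h: "orientation a s y > 0 \<and> orientation a y c > 0"
      by (rule cone_does_not_separate[OF E(3) ext(3) E(2) ext(2) 2(2) ab(2) sb pos y(1,2,5,4)])
    then have "orientation a y b > 0" using ey nz(3) swap by auto
    then have "orientation a c b > 0"
      using cone_does_not_separate[OF E(3) ext(3) E(1) ext(1) sb y(1) _ _ ac(2) ac(3)[symmetric] _ bc[symmetric]] h n
      by auto
    then show False using pos swap by simp
  next
    \<comment> \<open>The three rays surround \<open>a\<close>, so \<open>y\<close> must lie in one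
      of three cones. The first is empty, and membership in another would force \<open>b\<close> or
      \<open>c\<close> into it.\<close>
    case 3
    have cs: "orientation a c s > 0" and sb: "orientation a s b > 0" using 3 swap by auto
    have "\<not> (orientation a c y > 0 \<and> orientation a y s > 0)"
    proof
      assume h: "orientation a c y > 0 \<and> orientation a y s > 0"
      then have "orientation a c b > 0"
        using cone_does_not_separate[OF E(2) ext(2) E(3) ext(3) cs y(1) _ _ ab(2) ab(3)[symmetric] bc] n
        by auto
      then show False using pos swap by simp
    qed
    moreover have "\<not> (orientation a s y > 0 \<and> orientation a y b > 0)"
    proof
      assume h: "orientation a s y > 0 \<and> orientation a y b > 0"
      then have "orientation a c b > 0"
        using cone_does_not_separate[OF E(3) ext(3) E(1) ext(1) sb y(1) _ _ ac(2) ac(3)[symmetric] _ bc[symmetric]] n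
        by auto
      then show False using pos swap by simp
    qed
    moreover have "orientation a b y > 0 \<longleftrightarrow> \<not> orientation a y b > 0" "orientation a c y > 0 \<longleftrightarrow> \<not> orientation a y c > 0"
      "orientation a s y > 0 \<longleftrightarrow> \<not> orientation a y s > 0" using nz(3-5) swap by auto
    ultimately have "orientation a b y > 0 \<and> orientation a c y > 0 \<and> orientation a s y > 0 \<or>
       \<not> orientation a b y > 0 \<and> \<not> orientation a c y > 0 \<and> \<not> orientation a s y > 0"
      using ey by argo
    then have same: "(orientation a b y > 0 \<and> orientation a c y > 0 \<and> orientation a s y > 0) \<or>
       (orientation a b y < 0 \<and> orientation a c y < 0 \<and> orientation a s y < 0)"
      using nz(3-5) swap(3) by argo
    \<comment> \<open>Grassmann-Pluecker relation. Its coefficients are positive because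
      \<open>a\<close> is inside the triangle \<open>b c s\<close>, so the three values at
      \<open>y\<close> cannot share a sign.\<close>
    have id: "orientation a b c * orientation a s y + orientation a c s * orientation a b y +
        orientation a s b * orientation a c y = 0"
      by (simp add: orientation_def algebra_simps)
    from same show False
    proof
      assume "orientation a b y > 0 \<and> orientation a c y > 0 \<and> orientation a s y > 0"
      then have "orientation a b c * orientation a s y > 0" "orientation a c s * orientation a b y > 0"
        "orientation a s b * orientation a c y > 0" using pos cs sb by simp_all
      then show False using id by linarith
    next
      assume "orientation a b y < 0 \<and> orientation a c y < 0 \<and> orientation a s y < 0"
      then have "orientation a b c * orientation a s y < 0" "orientation a c s * orientation a b y < 0"
        "orientation a s b * orientation a c y < 0" using pos cs sb by (simp_all add: mult_pos_neg)
      then show False using id by linarith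
    qed
  qed
qed

text \<open>\<open>a\<close> is the first neighbour of \<open>b\<close> counterclockwise after
  \<open>c\<close>. Emptiness is stated for the open cone at \<open>a\<close>: no point of
  \<open>P\<close> is to the right of \<open>bc\<close>, so points of the cone would lie in the
  triangle.\<close>

lemma hull_edge_apex:
  assumes bP: "b \<in> P" and cP: "c \<in> P" and bc: "b \<noteq> c"
    and hull: "\<And>w. w \<in> P \<Longrightarrow> orientation b c w \<ge> 0"
  obtains a where "{a, b} \<in> E" "{a, c} \<in> E" "orientation a b c > 0"
    "\<And>y. y \<in> P \<Longrightarrow> \<not> (orientation a b y > 0 \<and> orientation a y c > 0)"
proof -
  have hpos: "orientation b c y > 0" if "y \<in> P" "y \<noteq> b" "y \<noteq> c" for y
    using hull[OF that(1)] orientation_nonzero[OF bP cP that(1)] that bc by fastforce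
  define N where "N = {y. {b, y} \<in> E \<and> y \<noteq> c}"
  have NP: "y \<in> P \<and> y \<noteq> b \<and> y \<noteq> c" if "y \<in> N" for y
    using that edgeD[of b y] by (auto simp: N_def)
  have "finite N" using NP finite_P finite_subset[of N P] by blast
  moreover have "N \<noteq> {}"
  proof -
    obtain s where s: "s \<in> P" "s \<noteq> b" "s \<noteq> c" using fifth_point by metis
    \<comment> \<open>The reflection of \<open>c\<close> in \<open>b\<close> reverses the line,
      turning the right-hand half-plane of \<open>neighbour_in_half_plane\<close> into the left side
      of \<open>bc\<close>.\<close>
    let ?d = "b + b - c"
    have d: "orientation b ?d y = - orientation b c y" for y
      by (simp add: orientation_def algebra_simps)
    obtain y where "{b, y} \<in> E" "orientation b ?d y < 0"
      using neighbour_in_half_plane[OF bP s(1), of ?d] hpos[OF s] d by auto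
    then have "y \<in> N" using d by (auto simp: N_def)
    then show ?thesis by auto
  qed
  ultimately obtain a where aN: "a \<in> N" and amin: "\<And>y. y \<in> N \<Longrightarrow> orientation b a y \<ge> 0"
    using angular_min[of N b c] NP hpos by blast
  have a: "a \<in> P" "a \<noteq> b" "a \<noteq> c" and baE: "{b, a} \<in> E" using NP[OF aN] aN by (auto simp: N_def)
  define D where "D = orientation b c a"
  have D: "D > 0" unfolding D_def using hpos a by blast
  \<comment> \<open>Coordinates with \<open>b = (0, 0)\<close>, \<open>c = (1, 0)\<close>,
    \<open>a = (0, 1)\<close>. By the choice of \<open>a\<close>, neighbours of \<open>b\<close>
    other than \<open>c\<close> have \<open>C <= 0\<close>.\<close>
  define C where "C w = orientation b w a / D" for w
  define H where "H w = orientation b c w / D" for w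
  have coord: "w = b + C w *\<^sub>R (c - b) + H w *\<^sub>R (a - b)" for w
    using orientation_coordinates[of b c a w] D unfolding C_def H_def D_def by simp
  have H_comb: "H ((1 - t) *\<^sub>R w + t *\<^sub>R w') = (1 - t) * H w + t * H w'" for t w w'
    by (simp add: H_def orientation_convex_combination add_divide_distrib)
  have C_comb: "C ((1 - t) *\<^sub>R w + t *\<^sub>R w') = (1 - t) * C w + t * C w'" for t w w'
    unfolding C_def orientation_rotate[of b _ a] orientation_rotate[of _ a b]
    by (simp add: orientation_convex_combination add_divide_distrib)
  have vals: "C b = 0" "H b = 0" "C c = 1" "H c = 0" "C a = 0" "H a = 1"
    using D by (simp_all add: C_def H_def D_def)
  have H0: "H y \<ge> 0" if "y \<in> P" for y using hull[OF that] D by (simp add: H_def)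
  have Hpos: "H y > 0" if "y \<in> P" "y \<noteq> b" "y \<noteq> c" for y using hpos[OF that] D by (simp add: H_def)
  have segH: "H z \<ge> 0" if uvz: "u \<in> P" "v \<in> P" "z \<in> closed_segment u v" for u v z
  proof -
    obtain t where "0 \<le> t" "t \<le> 1" "z = (1 - t) *\<^sub>R u + t *\<^sub>R v" using closed_segmentE[OF uvz(3)] .
    then show ?thesis using H0[OF uvz(1)] H0[OF uvz(2)] by (simp add: H_comb)
  qed
  have NC: "C y \<le> 0" if "y \<in> N" for y
    using amin[OF that] D orientation_swap[of b a y] by (simp add: C_def divide_le_0_iff)
  have on_ba: "z \<in> closed_segment b a" if "C z = 0" "0 \<le> H z" "H z \<le> 1" for z
    using coord[of z] that in_closed_segment_ray[of "H z" b a] by simp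
  \<comment> \<open>The points in the angle at \<open>b\<close> between \<open>c\<close> and
    \<open>a\<close>, with \<open>a\<close> included. The point \<open>p\<close> chosen below is,
    seen from \<open>c\<close>, the one closest in direction to \<open>b\<close>; it will turn out
    to be \<open>a\<close>.\<close>
  define Q where "Q = {y \<in> P. y \<noteq> b \<and> y \<noteq> c \<and> C y \<ge> 0}"
  have "finite Q" using finite_P by (simp add: Q_def)
  moreover have "Q \<noteq> {}" using a vals by (auto simp: Q_def)
  moreover have "orientation c (c + c - b) y > 0" if "y \<in> Q" for y
  proof -
    have "orientation c (c + c - b) y = orientation b c y" by (simp add: orientation_def algebra_simps)
    then show ?thesis using hpos[of y] that by (simp add: Q_def)
  qed
  ultimately obtain p where pQ: "p \<in> Q" and pmax: "\<And>y. y \<in> Q \<Longrightarrow> orientation c p y \<le> 0"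
    using angular_max[of Q c "c + c - b"] by blast
  have p: "p \<in> P" "p \<noteq> b" "p \<noteq> c" "C p \<ge> 0" using pQ by (auto simp: Q_def)
  \<comment> \<open>\<open>orientation c p\<close> up to the factor \<open>D\<close>: nonpositive on
    \<open>Q\<close>, positive at \<open>b\<close>.\<close>
  define f where "f w = (C p - 1) * H w - (C w - 1) * H p" for w
  have f_orientation: "orientation c p w = f w * D" for w
  proof -
    have "orientation c (b + r *\<^sub>R (c - b) + s *\<^sub>R (a - b)) (b + r' *\<^sub>R (c - b) + s' *\<^sub>R (a - b)) =
      ((r - 1) * s' - (r' - 1) * s) * orientation b c a" for r s r' s'
      by (simp add: orientation_def algebra_simps)
    then show ?thesis using coord[of p] coord[of w] unfolding f_def D_def by metis
  qed
  have f_comb: "f ((1 - t) *\<^sub>R w + t *\<^sub>R w') = (1 - t) * f w + t * f w'" for t w w'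
    unfolding f_def C_comb H_comb by (simp add: algebra_simps)
  have fQ: "f y \<le> 0" if "y \<in> Q" for y
    using pmax[OF that] D f_orientation[of y] by (simp add: mult_le_0_iff)
  have fvals: "f c = 0" "f b = H p" "f p = 0" by (simp_all add: f_def vals)
  have "a \<in> Q" using a vals by (simp add: Q_def)
  then have fa: "C p - 1 + H p \<le> 0" using fQ[of a] by (simp add: f_def vals)
  \<comment> \<open>An edge crossing \<open>bp\<close> has an end with \<open>f > 0\<close>, so
    outside \<open>Q\<close> and with \<open>C < 0\<close>. On the way there it meets the ray
    \<open>ba\<close> with \<open>f > 0\<close>, which forces \<open>H < 1\<close>, so it crosses
    the edge \<open>{b, a}\<close>.\<close>
  have "{b, p} \<in> E"
  proof (rule ccontr)
    assume "{b, p} \<notin> E"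
    then obtain u v x where uv: "{u, v} \<in> E" "u \<noteq> b" "u \<noteq> p" "v \<noteq> b" "v \<noteq> p"
      "x \<in> closed_segment u v" "x \<in> closed_segment b p"
      by (rule crossing_edgeE[OF bP p(1) p(2)[symmetric]]) blast
    note uvP = edgeD[OF uv(1)]
    have xp: "x \<noteq> p" using segment_Int_P[OF uvP(1,2) p(1)] uv by auto
    obtain t where t: "0 \<le> t" "t \<le> 1" "x = (1 - t) *\<^sub>R b + t *\<^sub>R p" using closed_segmentE[OF uv(7)] .
    have "t < 1" using t xp by (auto simp: order_le_less)
    have "f x = (1 - t) * H p" by (simp add: t(3) f_comb fvals)
    then have fx: "f x > 0" using \<open>t < 1\<close> Hpos[OF p(1-3)] by simp
    have Cx: "C x \<ge> 0" using t p by (simp add: C_comb vals)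
    obtain r where r: "0 \<le> r" "r \<le> 1" "x = (1 - r) *\<^sub>R u + r *\<^sub>R v" using closed_segmentE[OF uv(6)] .
    have "- f u < 0 \<or> - f v < 0"
      using fx convex_combination_neg_cases[OF r(1,2), of "- f u" "- f v"] by (simp add: r(3) f_comb)
    then obtain w w' where w: "{w, w'} = {u, v}" "f w > 0" by (metis insert_commute neg_less_0_iff_less)
    have wE: "{w, w'} \<in> E" using uv(1) w(1) by simp
    have wn: "w \<noteq> b" "w' \<noteq> b" using w(1) uv by (auto simp: doubleton_eq_iff)
    note wP = edgeD[OF wE]
    have "w \<notin> Q" using fQ[of w] w(2) by auto
    moreover have "w \<noteq> c" using w(2) fvals by auto
    ultimately have "C w < 0" using wP wn by (auto simp: Q_def)
    then obtain s where s: "0 \<le> s" "s \<le> 1" "(1 - s) * C x + s * C w = 0"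
      using affine_first_zero[OF Cx, of "C w"] by auto
    define z where "z = (1 - s) *\<^sub>R x + s *\<^sub>R w"
    have Cz: "C z = 0" using s by (simp add: z_def C_comb)
    have fz: "f z > 0" unfolding z_def f_comb using convex_combination_pos[OF s(1,2) fx w(2)] .
    have "x \<in> closed_segment w w'" using uv(6) w(1) by (simp add: segment_convex_hull)
    moreover have "z \<in> closed_segment x w" using s unfolding z_def in_segment by blast
    ultimately have zw: "z \<in> closed_segment w w'" using subset_closed_segment[of x w w w'] by auto
    have Hz: "H z \<ge> 0" using segH[OF wP(1,2) zw] .
    have Hz1: "H z < 1"
    proof (rule ccontr)
      assume "\<not> H z < 1"
      moreover have "C p - 1 \<le> 0" using fa Hpos[OF p(1-3)] by linarith
      ultimately have "(C p - 1) * H z \<le> (C p - 1) * 1" by (intro mult_left_mono_neg) auto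
      then show False using fz fa by (simp add: f_def Cz)
    qed
    have "{w, w'} \<noteq> {b, a}" using wn by (auto simp: doubleton_eq_iff)
    then have "z \<in> {w, w'} \<inter> {b, a}"
      using edges_cross[OF wE baE _ zw] on_ba[OF Cz Hz] Hz1 by simp
    then have "z = a" using wn by auto
    then show False using Hz1 vals by simp
  qed
  then have "p \<in> N" using p by (simp add: N_def)
  then have "C p = 0" using NC p(4) by force
  then have "orientation b p a = 0" using D by (simp add: C_def)
  then have pa: "p = a" using orientation_nonzero[OF bP p(1) a(1)] p(2) a(2) by auto
  have beyond: "C y + H y > 1" if yh: "y \<in> P" "y \<noteq> b" "y \<noteq> c" "y \<noteq> a" "C y \<ge> 0" for y
  proof -
    have "y \<in> Q" using yh by (simp add: Q_def)
    then have "C y + H y \<ge> 1" using fQ[of y] by (simp add: f_def pa vals)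
    moreover have "f y \<noteq> 0"
      using f_orientation[of y] orientation_nonzero[OF cP a(1) yh(1)] yh a pa by auto
    ultimately show ?thesis by (simp add: f_def pa vals)
  qed
  \<comment> \<open>An edge crossing \<open>ca\<close> has an end \<open>w\<close> with
    \<open>C > 0\<close>, hence beyond \<open>ca\<close>. The other end is on the near side and is
    not \<open>b\<close>, whose neighbours have \<open>C <= 0\<close> apart from \<open>c\<close>;
    so it has \<open>C < 0\<close>, and the edge crosses \<open>{b, a}\<close> before reaching
    it.\<close>
  have "{c, a} \<in> E"
  proof (rule ccontr)
    assume "{c, a} \<notin> E"
    then obtain u v x where uv: "{u, v} \<in> E" "u \<noteq> c" "u \<noteq> a" "v \<noteq> c" "v \<noteq> a"
      "x \<in> closed_segment u v" "x \<in> closed_segment c a"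
      by (rule crossing_edgeE[OF cP a(1) a(3)[symmetric]]) blast
    note uvP = edgeD[OF uv(1)]
    have xa: "x \<noteq> a" using segment_Int_P[OF uvP(1,2) a(1)] uv by auto
    obtain t where t: "0 \<le> t" "t \<le> 1" "x = (1 - t) *\<^sub>R c + t *\<^sub>R a" using closed_segmentE[OF uv(7)] .
    have "t < 1" using t xa by (auto simp: order_le_less)
    then have Cx: "C x > 0" by (simp add: t(3) C_comb vals)
    have Sx: "C x + H x = 1" by (simp add: t(3) C_comb H_comb vals)
    obtain r where r: "0 \<le> r" "r \<le> 1" "x = (1 - r) *\<^sub>R u + r *\<^sub>R v" using closed_segmentE[OF uv(6)] .
    have "- C u < 0 \<or> - C v < 0"
      using Cx convex_combination_neg_cases[OF r(1,2), of "- C u" "- C v"] by (simp add: r(3) C_comb)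
    then obtain w w' where w: "{w, w'} = {u, v}" "C w > 0" by (metis insert_commute neg_less_0_iff_less)
    have wE: "{w, w'} \<in> E" using uv(1) w(1) by simp
    have wn: "w \<noteq> c" "w' \<noteq> c" "w \<noteq> a" "w' \<noteq> a" using w(1) uv by (auto simp: doubleton_eq_iff)
    note wP = edgeD[OF wE]
    have wb: "w \<noteq> b" using w(2) vals by auto
    have Sw: "C w + H w > 1" using beyond[OF wP(1)] wn wb w(2) by simp
    have xw: "x \<in> closed_segment w w'" using uv(6) w(1) by (simp add: segment_convex_hull)
    obtain q where q: "0 \<le> q" "q \<le> 1" "x = (1 - q) *\<^sub>R w + q *\<^sub>R w'" using closed_segmentE[OF xw] .
    have Sw': "C w' + H w' \<le> 1"
    proof (rule ccontr)
      assume "\<not> ?thesis"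
      then have "(1 - q) * (C w + H w - 1) + q * (C w' + H w' - 1) > 0"
        using convex_combination_pos[OF q(1,2), of "C w + H w - 1" "C w' + H w' - 1"] Sw by simp
      moreover have "C x + H x = (1 - q) * C w + q * C w' + ((1 - q) * H w + q * H w')"
        unfolding q(3) C_comb H_comb ..
      ultimately show False using Sx by (simp add: algebra_simps)
    qed
    have w'b: "w' \<noteq> b"
    proof
      assume "w' = b"
      then have "w \<in> N" using wE wn by (simp add: N_def insert_commute)
      then show False using NC[of w] w(2) by simp
    qed
    have "C w' < 0" using beyond[OF wP(2) w'b] wn Sw' by force
    then obtain s where s: "0 \<le> s" "s \<le> 1" "(1 - s) * C x + s * C w' = 0"
      using affine_first_zero[of "C x" "C w'"] Cx by auto
    define z where "z = (1 - s) *\<^sub>R x + s *\<^sub>R w'"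
    have Cz: "C z = 0" using s by (simp add: z_def C_comb)
    have "z \<in> closed_segment x w'" using s unfolding z_def in_segment by blast
    then have zw: "z \<in> closed_segment w w'" using xw subset_closed_segment[of x w' w w'] by auto
    have Hz: "H z \<ge> 0" using segH[OF wP(1,2) zw] .
    have "C z + H z = (1 - s) * (C x + H x) + s * (C w' + H w')"
      unfolding z_def C_comb H_comb by (simp add: algebra_simps)
    also have "\<dots> \<le> (1 - s) * 1 + s * 1" using Sx Sw' s by (intro add_mono mult_left_mono) auto
    finally have Hz1: "H z \<le> 1" using Cz by simp
    have "{w, w'} \<noteq> {b, a}" using wn by (auto simp: doubleton_eq_iff)
    then have "z \<in> {w, w'} \<inter> {b, a}"
      using edges_cross[OF wE baE _ zw] on_ba[OF Cz Hz Hz1] by simp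
    then show False using wn wb w'b by auto
  qed
  moreover have "\<not> (orientation a b y > 0 \<and> orientation a y c > 0)" if "y \<in> P" for y
  proof
    assume o: "orientation a b y > 0 \<and> orientation a y c > 0"
    have ab: "orientation a b y = D * C y"
      using D orientation_rotate[of b y a] orientation_rotate[of y a b] by (simp add: C_def)
    have "orientation c a y = orientation a y c" by (rule orientation_rotate)
    then have "orientation a y c = (1 - C y - H y) * D" using f_orientation[of y] by (simp add: pa f_def vals)
    then have "C y + H y < 1" "C y > 0" using o ab D by (auto simp: zero_less_mult_iff)
    moreover have "y \<noteq> b" "y \<noteq> c" "y \<noteq> a" using o by auto
    ultimately show False using beyond[OF that] by force
  qed
  moreover have "orientation a b c > 0"
    using D orientation_rotate[of a b c] by (simp add: D_def)
  ultimately show ?thesis using that[of a] baE by (simp add: insert_commute)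
qed

end

section \<open>Edges of the convex hull\<close>

lemma edge_ofD:
  assumes "closed_segment b c edge_of convex hull X"
  shows "b \<noteq> c" "b \<in> X" "c \<in> X" "b extreme_point_of convex hull X" "c extreme_point_of convex hull X"
proof -
  have face: "closed_segment b c face_of convex hull X" and dim: "aff_dim (closed_segment b c) = 1"
    using assms by (simp_all add: edge_of_def)
  show "b \<noteq> c" using dim by auto
  show b: "b extreme_point_of convex hull X" and c: "c extreme_point_of convex hull X"
    using extreme_point_of_face[OF face, of b] extreme_point_of_face[OF face, of c]
    by (simp_all add: extreme_point_of_segment)
  show "b \<in> X" "c \<in> X" using b c by (simp_all add: extreme_point_of_convex_hull)
qed

text \<open>An edge is an exposed face, so some functional is maximal exactly on it. In the frame
  \<open>b\<close>, \<open>c\<close>, \<open>u\<close> with \<open>u\<close> off the line, this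
  makes the coordinate along \<open>u - b\<close> nonnegative, so all points are on the side of
  \<open>u\<close>.\<close>

lemma edge_of_one_sided:
  fixes X :: "(real^2) set"
  assumes fin: "finite X" and edge: "closed_segment b c edge_of convex hull X"
  shows "(\<forall>w\<in>X. orientation b c w \<ge> 0) \<or> (\<forall>w\<in>X. orientation b c w \<le> 0)"
proof (cases "\<forall>w\<in>X. orientation b c w = 0")
  case False
  then obtain u where u: "u \<in> X" "orientation b c u \<noteq> 0" by blast
  have "closed_segment b c exposed_face_of convex hull X"
    using edge fin by (simp add: edge_of_def exposed_face_of_polyhedron polyhedron_convex_hull)
  then obtain n k where n: "convex hull X \<subseteq> {x. n \<bullet> x \<le> k}"
    "closed_segment b c = convex hull X \<inter> {x. n \<bullet> x = k}"
    by (auto simp: exposed_face_of_def)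
  have "b \<in> closed_segment b c" "c \<in> closed_segment b c" by simp_all
  then have bc: "n \<bullet> b = k" "n \<bullet> c = k" using n(2) by auto
  have "u \<notin> closed_segment b c"
    using u(2) by (auto simp: in_segment orientation_convex_combination)
  then have nu: "n \<bullet> (u - b) < 0"
    using n u(1) bc hull_inc[of u X convex] by (force simp: inner_diff_right)
  have quot: "orientation b c w / orientation b c u \<ge> 0" if "w \<in> X" for w
  proof -
    define r s where "r = orientation b w u / orientation b c u"
      and "s = orientation b c w / orientation b c u"
    have w: "w = b + r *\<^sub>R (c - b) + s *\<^sub>R (u - b)"
      unfolding r_def s_def by (rule orientation_coordinates[OF u(2)])
    have "n \<bullet> w \<le> k" using n(1) hull_inc[OF that, of convex] by auto
    then have "s * (n \<bullet> (u - b)) \<le> 0"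
      unfolding w using bc by (simp add: inner_add_right inner_diff_right)
    then have "s \<ge> 0" using nu unfolding mult_le_0_iff by linarith
    then show ?thesis by (simp add: s_def)
  qed
  show ?thesis
  proof (cases "orientation b c u > 0")
    case True
    then show ?thesis using quot by (auto simp: zero_le_divide_iff)
  next
    case False
    then have "orientation b c u < 0" using u by simp
    then show ?thesis using quot by (auto simp: zero_le_divide_iff)
  qed
qed simp

lemma ccw_edgeD:
  assumes "ccw_edge X b c"
  shows "b \<noteq> c" "b \<in> X" "c \<in> X" "b extreme_point_of convex hull X" "c extreme_point_of convex hull X"
    "closed_segment b c edge_of convex hull X" "\<And>w. w \<in> X \<Longrightarrow> orientation b c w \<ge> 0"
proof -
  have e: "closed_segment b c edge_of convex hull X" using assms by (simp add: ccw_edge_def)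
  show "closed_segment b c edge_of convex hull X" by (rule e)
  show "b \<noteq> c" "b \<in> X" "c \<in> X" "b extreme_point_of convex hull X" "c extreme_point_of convex hull X"
    by (rule edge_ofD[OF e])+
  show "\<And>w. w \<in> X \<Longrightarrow> orientation b c w \<ge> 0" using assms by (simp add: ccw_edge_def)
qed

lemma no_three_collinear_orientation:
  assumes "no_three_collinear P" "a \<in> P" "b \<in> P" "c \<in> P" "a \<noteq> b" "b \<noteq> c" "a \<noteq> c"
  shows "orientation a b c \<noteq> 0"
  using assms unfolding no_three_collinear_def collinear_iff_orientation by simp

lemma ccw_edge_unique:
  assumes "no_three_collinear X" "ccw_edge X b c" "ccw_edge X b c'"
  shows "c = c'"
proof (rule ccontr)
  assume n: "c \<noteq> c'"
  note c = ccw_edgeD[OF assms(2)] and c' = ccw_edgeD[OF assms(3)]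
  have "orientation b c c' \<ge> 0" "orientation b c' c \<ge> 0" by (rule c(7)[OF c'(3)], rule c'(7)[OF c(3)])
  moreover have "orientation b c' c = - orientation b c c'" by (rule orientation_swap)
  moreover have "orientation b c c' \<noteq> 0"
    by (rule no_three_collinear_orientation[OF assms(1) c(2,3) c'(3) c(1) n c'(1)])
  ultimately show False by linarith
qed

text \<open>Separating \<open>b\<close> from the other points puts them into an open half-plane at
  \<open>b\<close>, which has an angularly first point \<open>c\<close>. The supporting line
  \<open>bc\<close> contains no third point, so it cuts out just the segment.\<close>

lemma ccw_edge_exists:
  assumes fin: "finite X" and no3: "no_three_collinear X" and other: "X \<noteq> {b}"
    and bX: "b \<in> X" and ext: "b extreme_point_of convex hull X"
  obtains c where "ccw_edge X b c"
proof -
  have "convex (convex hull X - {b})" using ext by (simp add: extreme_point_of_stillconvex)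
  then have "convex hull (X - {b}) \<subseteq> convex hull X - {b}"
    using hull_subset[of X convex] by (intro hull_minimal) auto
  then have "b \<notin> convex hull (X - {b})" by blast
  moreover have "closed (convex hull (X - {b}))"
    using fin by (simp add: compact_imp_closed finite_imp_compact_convex_hull)
  ultimately obtain n k where nk: "n \<bullet> b < k" "\<And>x. x \<in> convex hull (X - {b}) \<Longrightarrow> n \<bullet> x > k"
    using separating_hyperplane_closed_point[of "convex hull (X - {b})" b] by auto
  \<comment> \<open>\<open>d - b\<close> is \<open>n\<close> turned clockwise by a right angle, so
    \<open>orientation b d\<close> measures the height above \<open>b\<close> in direction
    \<open>n\<close>.\<close>
  define d :: "real^2" where "d = vector [b$1 + n$2, b$2 - n$1]"
  have "orientation b d y = n \<bullet> y - n \<bullet> b" for y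
    by (simp add: orientation_def d_def inner_vec_def sum_2 algebra_simps)
  then have "orientation b d y > 0" if "y \<in> X - {b}" for y
    using nk hull_inc[OF that, of convex] by force
  moreover have "X - {b} \<noteq> {}" using other bX by auto
  ultimately obtain c where c: "c \<in> X - {b}" "\<forall>y\<in>X - {b}. orientation b c y \<ge> 0"
    using angular_min[of "X - {b}" b d] fin by auto
  have pos: "orientation b c y \<ge> 0" if "y \<in> X" for y
    using c(2) that by (cases "y = b") auto
  define m :: "real^2" where "m = vector [b$2 - c$2, c$1 - b$1]"
  have m: "orientation b c z = m \<bullet> z - m \<bullet> b" for z
    unfolding m_def by (rule orientation_as_inner)
  let ?T = "convex hull X \<inter> {x. m \<bullet> x = m \<bullet> b}"
  have face: "?T face_of convex hull X"
  proof (rule face_of_Int_supporting_hyperplane_ge)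
    show "convex (convex hull X)" by (rule convex_convex_hull)
    show "m \<bullet> x \<ge> m \<bullet> b" if "x \<in> convex hull X" for x
      using orientation_ge_on_hull[of X b c x] pos that m[of x] by simp
  qed
  obtain X' where X': "X' \<subseteq> X" "?T = convex hull X'"
    using face_of_convex_hull_subset[OF finite_imp_compact[OF fin] face] by blast
  have "X' \<subseteq> {b, c}"
  proof
    fix x assume x: "x \<in> X'"
    then have "x \<in> ?T" using X'(2) hull_inc[of x X' convex] by simp
    then have "orientation b c x = 0" using m by simp
    then show "x \<in> {b, c}"
      using no_three_collinear_orientation[OF no3 bX, of c x] c(1) x X'(1) by auto
  qed
  then have "?T \<subseteq> convex hull {b, c}" unfolding X'(2) by (rule hull_mono)
  moreover have "convex hull {b, c} \<subseteq> ?T"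
  proof (rule hull_minimal)
    have "orientation b c c = 0" by simp
    then show "{b, c} \<subseteq> ?T" using m[of c] bX c(1) hull_inc[of _ X convex] by auto
    show "convex ?T" unfolding X'(2) by (rule convex_convex_hull)
  qed
  ultimately have T: "?T = closed_segment b c" by (simp add: segment_convex_hull)
  have "aff_dim (closed_segment b c) = 1"
    using c(1) by (auto simp: segment_convex_hull aff_dim_convex_hull)
  then have "closed_segment b c edge_of convex hull X" using face T by (simp add: edge_of_def)
  then have "ccw_edge X b c" using pos by (simp add: ccw_edge_def)
  then show ?thesis by (rule that)
qed

text \<open>By Caratheodory, \<open>a\<close> is in the hull of at most three other points. General
  position rules out fewer than three and zero weights, so \<open>a\<close> is interior to a
  triangle.\<close>

lemma interior_if_not_extreme:
  fixes P :: "(real^2) set"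
  assumes fin: "finite P" and no3: "no_three_collinear P" and aP: "a \<in> P"
    and ext: "\<not> a extreme_point_of convex hull P"
  shows "a \<in> interior (convex hull P)"
proof -
  have seg: "a \<notin> closed_segment p q" if "p \<in> P - {a}" "q \<in> P - {a}" for p q
  proof
    assume s: "a \<in> closed_segment p q"
    then have "orientation p q a = 0" by (auto simp: in_segment orientation_convex_combination)
    moreover have "p \<noteq> q" using s that by auto
    ultimately show False using no_three_collinear_orientation[OF no3, of p q a] that aP by auto
  qed
  have "a \<in> convex hull P" using aP by (rule hull_inc)
  have "a \<in> convex hull (P - {a})"
  proof (rule ccontr)
    assume n: "a \<notin> convex hull (P - {a})"
    show False
      using extreme_point_of_convex_hull_insert[of "P - {a}" a] n ext aP fin by (simp add: insert_absorb)
  qed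
  then obtain S where S: "finite S" "S \<subseteq> P - {a}" "card S \<le> DIM(real^2) + 1" "a \<in> convex hull S"
    unfolding caratheodory[of "P - {a}"] by blast
  have "card S \<le> 3" using S(3) by simp
  then consider "card S = 0" | "card S = 1" | "card S = 2" | "card S = 3" by linarith
  then show ?thesis
  proof cases
    case 1
    then show ?thesis using S by simp
  next
    case 2
    then obtain p where "S = {p}" by (auto simp: card_1_singleton_iff)
    then show ?thesis using S by simp
  next
    case 3
    then obtain p q where "S = {p, q}" by (auto simp: card_2_iff)
    then show ?thesis using S seg[of p q] by (simp add: segment_convex_hull)
  next
    case 4
    then obtain p q r where pqr: "S = {p, q, r}" "p \<noteq> q" "p \<noteq> r" "q \<noteq> r"
      by (auto simp: card_3_iff)
    have P: "p \<in> P - {a}" "q \<in> P - {a}" "r \<in> P - {a}" using S(2) pqr(1) by auto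
    obtain u v w where uvw: "0 \<le> u" "0 \<le> v" "0 \<le> w" "u + v + w = 1"
      "a = u *\<^sub>R p + v *\<^sub>R q + w *\<^sub>R r"
      using S(4) unfolding pqr(1) convex_hull_3 by blast
    have "u \<noteq> 0"
    proof
      assume "u = 0"
      moreover have "v = 1 - w" using uvw(4) \<open>u = 0\<close> by simp
      ultimately have "a = (1 - w) *\<^sub>R q + w *\<^sub>R r" "w \<le> 1" using uvw by simp_all
      then have "a \<in> closed_segment q r" using uvw(3) unfolding in_segment by blast
      then show False using seg P by blast
    qed
    moreover have "v \<noteq> 0"
    proof
      assume "v = 0"
      moreover have "u = 1 - w" using uvw(4) \<open>v = 0\<close> by simp
      ultimately have "a = (1 - w) *\<^sub>R p + w *\<^sub>R r" "w \<le> 1" using uvw by simp_all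
      then have "a \<in> closed_segment p r" using uvw(3) unfolding in_segment by blast
      then show False using seg P by blast
    qed
    moreover have "w \<noteq> 0"
    proof
      assume "w = 0"
      moreover have "u = 1 - v" using uvw(4) \<open>w = 0\<close> by simp
      ultimately have "a = (1 - v) *\<^sub>R p + v *\<^sub>R q" "v \<le> 1" using uvw by simp_all
      then have "a \<in> closed_segment p q" using uvw(2) unfolding in_segment by blast
      then show False using seg P by blast
    qed
    ultimately have "0 < u" "0 < v" "0 < w" using uvw by auto
    moreover have "\<not> collinear {p, q, r}"
      using no3 P pqr(2-4) unfolding no_three_collinear_def by blast
    ultimately have "a \<in> interior (convex hull {p, q, r})"
      using uvw(4,5) by (subst interior_convex_hull_3_minimal) auto
    moreover have "convex hull {p, q, r} \<subseteq> convex hull P" using P by (intro hull_mono) auto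
    ultimately show ?thesis using interior_mono by blast
  qed
qed

section \<open>Walks along the hull boundary\<close>

lemma deterministic_walks_meet:
  assumes "\<And>x y z. R x y \<Longrightarrow> R x z \<Longrightarrow> y = z"
    and "successively R (s # xs)" "successively R (s # ys)"
  shows "last (s # xs) \<in> set (s # ys) \<or> last (s # ys) \<in> set (s # xs)"
  using assms(2,3)
proof (induction xs arbitrary: s ys)
  case (Cons x xs)
  show ?case
  proof (cases ys)
    case (Cons y ys')
    have "R s x" "R s y" using Cons.prems Cons by simp_all
    then have "x = y" by (rule assms(1))
    then show ?thesis using Cons.IH[of x ys'] Cons.prems Cons by auto
  qed simp
qed simp

lemma successively_nextE:
  assumes "successively R xs" "a \<in> set xs" "a \<noteq> last xs"
  obtains b where "R a b" "b \<in> set xs"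
proof -
  obtain ys zs where xs: "xs = ys @ a # zs" using split_list[OF assms(2)] by blast
  then obtain b zs' where "zs = b # zs'" using assms(3) by (cases zs) auto
  then show ?thesis using assms(1) that[of b] xs by (simp add: successively_append_iff)
qed

lemma successively_prevE:
  assumes "successively R xs" "a \<in> set xs" "a \<noteq> hd xs"
  obtains b where "R b a" "b \<in> set xs"
proof -
  obtain ys zs where xs: "xs = ys @ a # zs" using split_list[OF assms(2)] by blast
  then have "ys \<noteq> []" using assms(3) by auto
  then have "R (last ys) a" "last ys \<in> set xs" using assms(1) xs by (simp_all add: successively_append_iff)
  then show ?thesis by (rule that)
qed

text \<open>By uniqueness of successors, of the tails of the two walks from a common
  \<open>s\<close> one ends on the other: \<open>p\<close> would recur on the walk starting in
  \<open>p\<close>, or \<open>q\<close> on the walk starting in \<open>q\<close>, against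
  distinctness.\<close>

lemma ccw_walks_disjoint:
  assumes no3: "no_three_collinear P" and walk: "ccw_walk P q p vs"
    and between: "s \<in> ccw_strictly_between P p q"
  shows "s \<notin> set vs"
proof
  assume sv: "s \<in> set vs"
  obtain us where us: "ccw_walk P p q us" "s \<in> set us" "s \<noteq> p" "s \<noteq> q"
    using between unfolding ccw_strictly_between_def by blast
  obtain us1 us2 where u: "us = us1 @ s # us2" using split_list[OF us(2)] by blast
  obtain vs1 vs2 where v: "vs = vs1 @ s # vs2" using split_list[OF sv] by blast
  have us1: "us1 \<noteq> []" "hd us1 = p" using us u by (auto simp: ccw_walk_def hd_append split: if_splits)
  have vs1: "vs1 \<noteq> []" "hd vs1 = q" using us walk v by (auto simp: ccw_walk_def hd_append split: if_splits)
  have "p \<in> set us1" "q \<in> set vs1" using us1 vs1 hd_in_set by blast+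
  then have "p \<notin> set (s # us2)" "q \<notin> set (s # vs2)"
    using us(1) walk u v by (auto simp: ccw_walk_def)
  moreover have "successively (ccw_edge P) (s # us2)" "successively (ccw_edge P) (s # vs2)"
    using us(1) walk u v by (auto simp: ccw_walk_def successively_append_iff)
  moreover have "last (s # us2) = q" "last (s # vs2) = p"
    using us(1) walk u v by (auto simp: ccw_walk_def)
  ultimately show False
    using deterministic_walks_meet[of "ccw_edge P" s us2 vs2] ccw_edge_unique[OF no3] by metis
qed

lemma ccw_strictly_between_extreme:
  assumes "s \<in> ccw_strictly_between P p q"
  shows "s extreme_point_of convex hull P"
proof -
  obtain us where us: "ccw_walk P p q us" "s \<in> set us" "s \<noteq> p"
    using assms unfolding ccw_strictly_between_def by blast
  then have "successively (ccw_edge P) us" "s \<noteq> hd us" by (auto simp: ccw_walk_def)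
  then obtain r where "ccw_edge P r s" using successively_prevE us(2) by metis
  then show ?thesis by (rule ccw_edgeD)
qed

section \<open>The faces along the hull\<close>

lemma triangle_orientation_interior:
  assumes pos: "orientation a b c > 0" and x: "x \<in> interior (convex hull {a, b, c})"
  shows "orientation a b x > 0" "orientation b c x > 0" "orientation c a x > 0"
proof -
  have rot: "orientation b c a > 0" "orientation c a b > 0"
    using pos orientation_rotate[of a b c] orientation_rotate[of b c a] by simp_all
  have ne: "a \<noteq> b" "b \<noteq> c" "c \<noteq> a" using pos by auto
  show "orientation a b x > 0" by (rule orientation_gt_on_interior[OF ne(1) _ x]) (use pos in simp)
  show "orientation b c x > 0" by (rule orientation_gt_on_interior[OF ne(2) _ x]) (use rot in simp)
  show "orientation c a x > 0" by (rule orientation_gt_on_interior[OF ne(3) _ x]) (use rot in simp)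
qed

lemma triangle_frontier:
  fixes a b c :: "real^2"
  assumes pos: "orientation a b c > 0" and y: "y \<in> convex hull {a, b, c}" "y \<notin> interior (convex hull {a, b, c})"
  shows "y \<in> closed_segment a b \<or> y \<in> closed_segment b c \<or> y \<in> closed_segment c a"
proof -
  obtain u v w where uvw: "0 \<le> u" "0 \<le> v" "0 \<le> w" "u + v + w = 1"
    "y = u *\<^sub>R a + v *\<^sub>R b + w *\<^sub>R c"
    using y(1) unfolding convex_hull_3 by blast
  have "\<not> collinear {a, b, c}" using pos by (simp add: collinear_iff_orientation)
  then have "\<not> (0 < u \<and> 0 < v \<and> 0 < w)"
    using y(2) uvw(4,5) by (subst (asm) interior_convex_hull_3_minimal) auto
  then consider "u = 0" | "v = 0" | "w = 0" using uvw(1-3) by linarith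
  then show ?thesis
  proof cases
    case 1
    moreover have "v = 1 - w" using uvw(4) 1 by simp
    ultimately have "y = (1 - w) *\<^sub>R b + w *\<^sub>R c" "w \<le> 1" using uvw by simp_all
    then have "y \<in> closed_segment b c" using uvw(3) unfolding in_segment by blast
    then show ?thesis by simp
  next
    case 2
    moreover have "w = 1 - u" using uvw(4) 2 by simp
    ultimately have "y = (1 - u) *\<^sub>R c + u *\<^sub>R a" "u \<le> 1" using uvw by simp_all
    then have "y \<in> closed_segment c a" using uvw(1) unfolding in_segment by blast
    then show ?thesis by simp
  next
    case 3
    moreover have "u = 1 - v" using uvw(4) 3 by simp
    ultimately have "y = (1 - v) *\<^sub>R a + v *\<^sub>R b" "v \<le> 1" using uvw by simp_all
    then have "y \<in> closed_segment a b" using uvw(2) unfolding in_segment by blast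
    then show ?thesis by simp
  qed
qed

lemma orientation_closed_segment: "z \<in> closed_segment a b \<Longrightarrow> orientation a b z = 0"
  by (auto simp: in_segment orientation_convex_combination)

text \<open>Finiteness makes \<open>Max\<close> in \<open>max_hull_inward\<close> an upper bound for
  its members.\<close>

lemma finite_maximal_compatible:
  assumes "finite P"
  shows "finite {Tc. maximal_compatible P Tc}"
proof (rule finite_subset)
  show "{Tc. maximal_compatible P Tc} \<subseteq> Pow (P \<times> Pow P)"
  proof (intro subsetI PowI)
    fix Tc T assume "Tc \<in> {Tc. maximal_compatible P Tc}" "T \<in> Tc"
    then have "inward_triangle P T" by (simp add: maximal_compatible_def compatible_def)
    then obtain b c where "snd T = {b, c}" "closed_segment b c edge_of convex hull P" "fst T \<in> P"
      unfolding inward_triangle_def interior_points_def by blast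
    moreover from edge_ofD(2,3)[OF this(2)] have "b \<in> P" "c \<in> P" .
    ultimately show "T \<in> P \<times> Pow P" by (simp add: mem_Times_iff)
  qed
qed (use assms in simp)

context maximal_plane_graph
begin

lemma hull_edge_in_graph:
  assumes "ccw_edge P b c"
  shows "{b, c} \<in> E"
proof (rule ccontr)
  note bc = ccw_edgeD[OF assms]
  assume "{b, c} \<notin> E"
  then obtain u v z where uv: "{u, v} \<in> E" "u \<noteq> b" "u \<noteq> c" "v \<noteq> b" "v \<noteq> c"
    "z \<in> closed_segment u v" "z \<in> closed_segment b c"
    by (rule crossing_edgeE[OF bc(2,3,1)]) blast
  note uvP = edgeD[OF uv(1)]
  have "orientation b c u > 0" "orientation b c v > 0"
    using bc(7)[OF uvP(1)] bc(7)[OF uvP(2)] orientation_nonzero[OF bc(2,3) uvP(1) bc(1)]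
      orientation_nonzero[OF bc(2,3) uvP(2) bc(1)] uv(2-5) by auto
  moreover obtain t where "0 \<le> t" "t \<le> 1" "z = (1 - t) *\<^sub>R u + t *\<^sub>R v"
    using closed_segmentE[OF uv(6)] .
  ultimately have "orientation b c z > 0"
    using convex_combination_pos by (simp add: orientation_convex_combination)
  then show False using orientation_closed_segment[OF uv(7)] by simp
qed

text \<open>The base is directed, so \<open>b\<close> alone determines \<open>c\<close>. The last
  clause is emptiness of the triangle, expressed by the cone at \<open>a\<close>.\<close>

definition hull_face :: "real^2 \<Rightarrow> real^2 \<Rightarrow> real^2 \<Rightarrow> bool" where
  "hull_face a b c \<longleftrightarrow> ccw_edge P b c \<and> {a, b} \<in> E \<and> {a, c} \<in> E \<and> orientation a b c > 0 \<and>
     (\<forall>y\<in>P. \<not> (orientation a b y > 0 \<and> orientation a y c > 0))"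

lemma hull_faceD:
  assumes "hull_face a b c"
  shows "ccw_edge P b c" "{a, b} \<in> E" "{a, c} \<in> E" "orientation a b c > 0"
    "\<And>y. y \<in> P \<Longrightarrow> \<not> (orientation a b y > 0 \<and> orientation a y c > 0)"
  using assms by (simp_all add: hull_face_def)

lemma hull_face_exists:
  assumes "b \<in> hull_vertices P"
  obtains a c where "hull_face a b c"
proof -
  have b: "b \<in> P" "b extreme_point_of convex hull P" using assms by (simp_all add: hull_vertices_def)
  have "P \<noteq> {b}" using card_P by auto
  then obtain c where c: "ccw_edge P b c" using ccw_edge_exists[OF finite_P no3 _ b] by blast
  note bc = ccw_edgeD[OF c]
  obtain a where "{a, b} \<in> E" "{a, c} \<in> E" "orientation a b c > 0"
    "\<And>y. y \<in> P \<Longrightarrow> \<not> (orientation a b y > 0 \<and> orientation a y c > 0)"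
    using hull_edge_apex[OF bc(2,3,1,7)] by blast
  then have "hull_face a b c" using c by (simp add: hull_face_def)
  then show ?thesis by (rule that)
qed

text \<open>If \<open>a\<close> were a hull vertex, \<open>ab\<close> and \<open>ca\<close> would be
  chords between hull vertices, with every further point on the inner side of both and thus in the
  empty cone at \<open>a\<close>.\<close>

lemma hull_face_apex_interior:
  assumes "hull_face a b c"
  shows "a \<in> interior_points P"
proof -
  note h = hull_faceD[OF assms] and bc = ccw_edgeD[OF hull_faceD(1)[OF assms]]
  have aP: "a \<in> P" using edgeD(1)[OF h(2)] .
  have "\<not> a extreme_point_of convex hull P"
  proof
    assume ext: "a extreme_point_of convex hull P"
    obtain y where y: "y \<in> P" "y \<noteq> a" "y \<noteq> b" "y \<noteq> c" by (rule fifth_point)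
    have "orientation a b y > 0"
      by (rule extremes_orientation_sign[OF h(2) ext bc(4) bc(3) h(4) y])
    moreover have ca: "{c, a} \<in> E" using h(3) by (simp add: insert_commute)
    have "orientation c a b > 0" using h(4) orientation_rotate[of c a b] by simp
    then have "orientation c a y > 0"
      by (rule extremes_orientation_sign[OF ca bc(5) ext bc(2) _ y(1,4,2,3)])
    then have "orientation a y c > 0" using orientation_rotate[of c a y] by simp
    ultimately show False using h(5)[OF y(1)] by simp
  qed
  then have "a \<in> interior (convex hull P)" by (rule interior_if_not_extreme[OF finite_P no3 aP])
  then show ?thesis using aP by (simp add: interior_points_def)
qed

lemma interior_point_not_extreme:
  assumes "a \<in> interior_points P"
  shows "\<not> a extreme_point_of convex hull P"
  using assms extreme_point_not_in_interior by (auto simp: interior_points_def)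

lemma hull_face_neighbour:
  assumes "hull_face a b c" "{a, s} \<in> E" "s extreme_point_of convex hull P"
  shows "s = b \<or> s = c"
proof -
  note h = hull_faceD[OF assms(1)] and bc = ccw_edgeD[OF hull_faceD(1)[OF assms(1)]]
  show ?thesis by (rule hull_neighbours_of_apex[OF h(2,3) assms(2) bc(4,5) assms(3) h(4,5)])
qed

text \<open>A point \<open>a\<close> of the chain has a supporting line of \<open>Q\<close> through it, and a neighbour beyond that
  line belongs to \<open>S\<close>; this is a third hull neighbour of \<open>a\<close>.\<close>

lemma hull_face_not_forbidden:
  assumes "hull_face a b c"
  shows "\<not> forbidden P (a, {b, c})"
proof
  assume "forbidden P (a, {b, c})"
  then obtain p q where base: "{b, c} \<in> ccw_boundary_edges P q p" and chain: "a \<in> qchain_cc P p q"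
    unfolding forbidden_def cw_boundary_edges_def by auto
  define S where "S = ccw_strictly_between P p q"
  define Q where "Q = P - S"
  have "a \<in> ccw_strictly_between Q p q" using chain by (simp add: qchain_cc_def S_def Q_def Let_def)
  then obtain vs where vs: "ccw_walk Q p q vs" "a \<in> set vs" "a \<noteq> q"
    unfolding ccw_strictly_between_def by blast
  then have "successively (ccw_edge Q) vs" "a \<noteq> last vs" by (auto simp: ccw_walk_def)
  then obtain d where d: "ccw_edge Q a d" using successively_nextE vs(2) by metis
  note ad = ccw_edgeD[OF d]
  have aI: "a \<in> interior (convex hull P)" and aP: "a \<in> P"
    using hull_face_apex_interior[OF assms] by (simp_all add: interior_points_def)
  have "\<exists>w\<in>P. orientation a d w < 0"
  proof (rule ccontr)
    assume "\<not> ?thesis"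
    then have "\<forall>w\<in>P. orientation a d w \<ge> 0" by auto
    then have "orientation a d a > 0" by (rule orientation_gt_on_interior[OF ad(1) _ aI])
    then show False by simp
  qed
  then obtain w where "w \<in> P" "orientation a d w < 0" by blast
  then obtain s where s: "{a, s} \<in> E" "orientation a d s < 0"
    using neighbour_in_half_plane[OF aP] by blast
  have "s \<notin> Q" using ad(7)[of s] s(2) by auto
  then have sS: "s \<in> ccw_strictly_between P p q" using edgeD(2)[OF s(1)] by (simp add: Q_def S_def)
  then have "s = b \<or> s = c"
    using hull_face_neighbour[OF assms s(1)] ccw_strictly_between_extreme by blast
  \<comment> \<open>Both ends of the base lie on the walk from \<open>q\<close> to \<open>p\<close>,
    which avoids \<open>S\<close>, whereas \<open>s\<close> is one of them and lies in
    \<open>S\<close>.\<close>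
  moreover obtain b' c' us ws where walk: "{b, c} = {b', c'}" "ccw_walk P q p (us @ b' # c' # ws)"
    using base unfolding ccw_boundary_edges_def mem_Collect_eq by metis
  have "{b', c'} \<subseteq> set (us @ b' # c' # ws)" by simp
  then have "b \<in> set (us @ b' # c' # ws)" "c \<in> set (us @ b' # c' # ws)"
    unfolding walk(1)[symmetric] by blast+
  ultimately show False using ccw_walks_disjoint[OF no3 walk(2) sS] by metis
qed

section \<open>Faces over different hull edges do not overlap\<close>

lemma hull_face_Int_P:
  assumes "hull_face a b c"
  shows "P \<inter> convex hull {a, b, c} = {a, b, c}"
proof
  note h = hull_faceD[OF assms] and bc = ccw_edgeD[OF hull_faceD(1)[OF assms]]
  note ab = edgeD[OF h(2)] and ac = edgeD[OF h(3)]
  show "{a, b, c} \<subseteq> P \<inter> convex hull {a, b, c}" using ab ac by (auto intro: hull_inc)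
  show "P \<inter> convex hull {a, b, c} \<subseteq> {a, b, c}"
  proof
    fix y assume "y \<in> P \<inter> convex hull {a, b, c}"
    then have y: "y \<in> P" "y \<in> convex hull {a, b, c}" by auto
    have cab: "orientation c a b > 0" using h(4) orientation_rotate[of c a b] by simp
    have 1: "orientation a b y \<ge> 0"
      by (rule orientation_ge_on_hull[OF _ y(2)]) (use h(4) in simp)
    have 2: "orientation c a y \<ge> 0"
      by (rule orientation_ge_on_hull[OF _ y(2)]) (use cab in simp)
    have "orientation a y c \<ge> 0" using 2 orientation_rotate[of c a y] by simp
    then have "orientation a b y = 0 \<or> orientation c a y = 0"
      using h(5)[OF y(1)] 1 orientation_rotate[of c a y] by auto
    then show "y \<in> {a, b, c}"
      using orientation_nonzero[OF ab(1,2) y(1) ab(3)] orientation_nonzero[OF ac(2,1) y(1)] ac(3) by auto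
  qed
qed

text \<open>Followed from an interior point \<open>x\<close> to an end \<open>p\<close> that is not
  a vertex, an edge would leave the triangle on one of its sides. These are edges, so the exit point
  is a vertex and equals the other end \<open>q\<close>, which forces \<open>x\<close> into
  \<open>{p, q}\<close>. Hence both ends are vertices and the edge is a side.\<close>

lemma hull_face_interior_disjoint_edge:
  assumes face: "hull_face a b c" and e: "{u, v} \<in> E" "x \<in> closed_segment u v"
  shows "x \<notin> interior (convex hull {a, b, c})"
proof
  let ?I = "interior (convex hull {a, b, c})"
  assume x: "x \<in> ?I"
  note h = hull_faceD[OF face]
  have bcE: "{b, c} \<in> E" and caE: "{c, a} \<in> E"
    using hull_edge_in_graph[OF h(1)] h(3) by (simp_all add: insert_commute)
  have outside: "z \<notin> ?I" if "z \<in> closed_segment a b \<or> z \<in> closed_segment b c \<or> z \<in> closed_segment c a" for z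
  proof
    assume "z \<in> ?I"
    from triangle_orientation_interior[OF h(4) this] show False
      using that orientation_closed_segment[of z a b] orientation_closed_segment[of z b c]
        orientation_closed_segment[of z c a] by linarith
  qed
  have tri: "p \<in> {a, b, c}" if pq: "{p, q} \<in> E" "x \<in> closed_segment p q" for p q
  proof (rule ccontr)
    assume pn: "p \<notin> {a, b, c}"
    have pnI: "p \<notin> ?I"
      using hull_face_Int_P[OF face] edgeD(1)[OF pq(1)] interior_subset pn by blast
    have "closed_segment x p \<inter> frontier ?I \<noteq> {}"
    proof (rule connected_Int_frontier)
      show "closed_segment x p \<inter> ?I \<noteq> {}" using x by auto
      show "closed_segment x p - ?I \<noteq> {}" using pnI by auto
    qed simp
    then obtain y where y: "y \<in> closed_segment x p" "y \<in> frontier ?I" by blast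
    have "closure ?I \<subseteq> convex hull {a, b, c}"
      by (rule closure_minimal[OF interior_subset]) (simp add: compact_imp_closed finite_imp_compact_convex_hull)
    then have yh: "y \<in> convex hull {a, b, c}" "y \<notin> ?I"
      using y(2) by (auto simp: frontier_def)
    have ypq: "y \<in> closed_segment p q" using y(1) pq(2) subset_closed_segment[of x p p q] by auto
    have meet: "y \<in> {p, q} \<inter> {a, b, c}" if f: "{r, s} \<in> E" "y \<in> closed_segment r s"
      "r \<in> {a, b, c}" "s \<in> {a, b, c}" for r s
    proof -
      have "{p, q} \<noteq> {r, s}" using pn f(3,4) by auto
      from edges_cross[OF pq(1) f(1) this ypq f(2)] show ?thesis using f(3,4) by auto
    qed
    from triangle_frontier[OF h(4) yh] have "y \<in> {p, q} \<inter> {a, b, c}"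
      using meet[OF h(2)] meet[OF bcE] meet[OF caE] by auto
    then have yy: "y \<in> {p, q}" "y \<in> {a, b, c}" by auto
    then have yq: "y = q" using pn by auto
    then have "closed_segment p q \<subseteq> closed_segment x p" using y(1) by (simp add: subset_closed_segment)
    moreover have "closed_segment x p \<subseteq> closed_segment p q" using pq(2) by (simp add: subset_closed_segment)
    ultimately have "closed_segment x p = closed_segment p q" by auto
    then have "x \<in> {p, q}" unfolding closed_segment_eq by auto
    then show False using x pnI yq yh(2) by auto
  qed
  have "u \<in> {a, b, c}" by (rule tri[OF e])
  moreover have "v \<in> {a, b, c}"
    by (rule tri[of v u]) (use e in \<open>simp_all add: insert_commute closed_segment_commute\<close>)
  ultimately have "x \<in> closed_segment a b \<or> x \<in> closed_segment b c \<or> x \<in> closed_segment c a"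
    using edgeD(3)[OF e(1)] e(2) by (auto simp: closed_segment_commute)
  then show False using outside x by blast
qed

text \<open>A vertex \<open>w\<close> of the first triangle that is no vertex of the second lies
  outside it. The segment from \<open>x\<close> to \<open>w\<close> then leaves the second triangle
  on a side, at an interior point of the first, which no edge reaches.\<close>

lemma hull_faces_meet_subset:
  assumes f1: "hull_face a b c" and f2: "hull_face a' d e"
    and x: "x \<in> interior (convex hull {a, b, c})" "x \<in> interior (convex hull {a', d, e})"
  shows "{a, b, c} \<subseteq> {a', d, e}"
proof
  let ?H = "convex hull {a', d, e}"
  fix w assume w: "w \<in> {a, b, c}"
  show "w \<in> {a', d, e}"
  proof (rule ccontr)
    assume n: "w \<notin> {a', d, e}"
    have wP: "w \<in> P" and wh: "w \<in> convex hull {a, b, c}" using w hull_face_Int_P[OF f1] by blast+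
    then have wH: "w \<notin> ?H" using hull_face_Int_P[OF f2] n by blast
    have "closed_segment x w \<inter> frontier (interior ?H) \<noteq> {}"
    proof (rule connected_Int_frontier)
      show "closed_segment x w \<inter> interior ?H \<noteq> {}" using x by auto
      show "closed_segment x w - interior ?H \<noteq> {}" using wH interior_subset by auto
    qed simp
    then obtain z where z: "z \<in> closed_segment x w" "z \<in> frontier (interior ?H)" by blast
    have "closure (interior ?H) \<subseteq> ?H"
      by (rule closure_minimal[OF interior_subset]) (simp add: compact_imp_closed finite_imp_compact_convex_hull)
    then have zh: "z \<in> ?H" "z \<notin> interior ?H" using z(2) by (auto simp: frontier_def)
    then have "z \<in> open_segment x w" using z(1) wH x(2) by (auto simp: open_segment_def)
    moreover have "open_segment x w \<subseteq> interior (convex hull {a, b, c})"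
      using x(1) wh closure_subset by (intro in_interior_closure_convex_segment) auto
    ultimately have zI: "z \<in> interior (convex hull {a, b, c})" by blast
    note h = hull_faceD[OF f2]
    have "{d, e} \<in> E" "{e, a'} \<in> E"
      using hull_edge_in_graph[OF h(1)] h(3) by (simp_all add: insert_commute)
    from triangle_frontier[OF h(4) zh] show False
      using hull_face_interior_disjoint_edge[OF f1 h(2), of z] zI
        hull_face_interior_disjoint_edge[OF f1 \<open>{d, e} \<in> E\<close>, of z]
        hull_face_interior_disjoint_edge[OF f1 \<open>{e, a'} \<in> E\<close>, of z] by argo
  qed
qed

lemma hull_faces_interior_disjoint:
  assumes f1: "hull_face a b c" and f2: "hull_face a' d e" and ne: "a \<noteq> a'"
  shows "interior (convex hull {a, b, c}) \<inter> interior (convex hull {a', d, e}) = {}"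
proof (rule ccontr)
  assume "\<not> ?thesis"
  then have "a \<in> {a', d, e}" using hull_faces_meet_subset[OF f1 f2] by blast
  then have "a = d \<or> a = e" using ne by auto
  then show False
    using ccw_edgeD(4,5)[OF hull_faceD(1)[OF f2]]
      interior_point_not_extreme[OF hull_face_apex_interior[OF f1]] by auto
qed

lemma ccw_edge_asym: "ccw_edge P b c \<Longrightarrow> \<not> ccw_edge P c b"
proof
  assume e: "ccw_edge P b c" "ccw_edge P c b"
  note bc = ccw_edgeD[OF e(1)] and cb = ccw_edgeD[OF e(2)]
  obtain y where y: "y \<in> P" "y \<noteq> b" "y \<noteq> c" using fifth_point by metis
  have "orientation b c y \<ge> 0" "orientation c b y \<ge> 0" using bc(7)[OF y(1)] cb(7)[OF y(1)] by auto
  moreover have "orientation c b y = - orientation b c y" by (simp add: orientation_def algebra_simps)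
  ultimately show False using orientation_nonzero[OF bc(2,3) y(1) bc(1)] y by auto
qed

lemma ccw_edge_same_base:
  assumes "ccw_edge P b c" "ccw_edge P d e" "{b, c} = {d, e}"
  shows "b = d" "c = e"
  using assms ccw_edge_asym[of b c] by (auto simp: doubleton_eq_iff)

text \<open>The ends of the base are exactly the hull neighbours of the apex, so the apex determines
  the base.\<close>

lemma hull_face_same_apex:
  assumes "hull_face a b c" "hull_face a d e"
  shows "b = d" "c = e"
proof -
  note h = hull_faceD[OF assms(2)] and de = ccw_edgeD[OF hull_faceD(1)[OF assms(2)]]
  have "d = b \<or> d = c" "e = b \<or> e = c"
    using hull_face_neighbour[OF assms(1) h(2) de(4)] hull_face_neighbour[OF assms(1) h(3) de(5)] by auto
  then have "{b, c} = {d, e}" using de(1) by auto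
  then show "b = d" "c = e" using ccw_edge_same_base[OF hull_faceD(1)[OF assms(1)] h(1)] by auto
qed

lemma hull_face_inward:
  assumes "hull_face a b c"
  shows "inward_triangle P (a, {b, c})"
proof -
  note h = hull_faceD[OF assms] and bc = ccw_edgeD[OF hull_faceD(1)[OF assms]]
  have "y \<notin> triangle_interior (a, {b, c})" if "y \<in> P" for y
  proof
    assume y: "y \<in> triangle_interior (a, {b, c})"
    note o = triangle_orientation_interior[OF h(4) y[unfolded triangle_interior_def fst_conv snd_conv]]
    have "orientation a y c > 0" using o(3) orientation_rotate[of c a y] by simp
    then show False using o(1) h(5)[OF that] by simp
  qed
  then show ?thesis
    using bc(6) hull_face_apex_interior[OF assms] by (auto simp: inward_triangle_def)
qed

lemma hull_faces_compatible:
  assumes f1: "hull_face a b c" and f2: "hull_face a' d e" and ne: "b \<noteq> d"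
  shows "triangle_edges (a, {b, c}) \<inter> triangle_edges (a', {d, e}) = {}" "a \<noteq> a'"
    "triangle_interior (a, {b, c}) \<inter> triangle_interior (a', {d, e}) = {}"
proof -
  show aa: "a \<noteq> a'" using hull_face_same_apex(1)[of a b c d e] f1 f2 ne by auto
  note bc = ccw_edgeD[OF hull_faceD(1)[OF f1]] and de = ccw_edgeD[OF hull_faceD(1)[OF f2]]
  note na = interior_point_not_extreme[OF hull_face_apex_interior[OF f1]]
    and na' = interior_point_not_extreme[OF hull_face_apex_interior[OF f2]]
  have n: "a \<noteq> b" "a \<noteq> c" "a \<noteq> d" "a \<noteq> e" "a' \<noteq> b" "a' \<noteq> c" "a' \<noteq> d" "a' \<noteq> e"
    using na na' bc(4,5) de(4,5) by auto
  have "{b, c} \<noteq> {d, e}"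
    using ccw_edge_same_base(1)[OF hull_faceD(1)[OF f1] hull_faceD(1)[OF f2]] ne by blast
  then show "triangle_edges (a, {b, c}) \<inter> triangle_edges (a', {d, e}) = {}"
    using n aa by (auto simp: triangle_edges_def doubleton_eq_iff)
  show "triangle_interior (a, {b, c}) \<inter> triangle_interior (a', {d, e}) = {}"
    using hull_faces_interior_disjoint[OF f1 f2 aa] by (simp add: triangle_interior_def)
qed

section \<open>Counting the faces\<close>

text \<open>Each hull vertex \<open>b\<close> is assigned the face over the hull edge leaving it
  counterclockwise, so faces are counted by hull vertices directly. Sums instead of differences
  avoid truncated subtraction on \<open>nat\<close>.\<close>

lemma card_hull_vertices_le:
  "card (hull_vertices P) + card (hull_vertices (interior_points P))
    \<le> card (interior_points P) + max_hull_inward P"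
proof -
  let ?V = "hull_vertices P" and ?I = "interior_points P"
  have "\<exists>f. \<forall>b\<in>?V. hull_face (fst (f b)) b (snd (f b))"
    by (rule bchoice) (metis hull_face_exists fst_conv snd_conv)
  then obtain f where f: "\<And>b. b \<in> ?V \<Longrightarrow> hull_face (fst (f b)) b (snd (f b))" by blast
  define apex where "apex b = fst (f b)" for b
  define succ where "succ b = snd (f b)" for b
  define face where "face b = (apex b, {b, succ b})" for b
  have hf: "hull_face (apex b) b (succ b)" if "b \<in> ?V" for b
    using f[OF that] by (simp add: apex_def succ_def)
  define Tc where "Tc = face ` ?V"
  have apex_inj: "inj_on apex ?V"
    using hull_face_same_apex(1) hf by (metis inj_onI)
  then have fst_inj: "inj_on fst Tc" "inj_on face ?V"
    unfolding Tc_def face_def by (auto simp: inj_on_def)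
  have compat: "compatible P Tc"
    unfolding compatible_def
  proof (intro conjI ballI impI)
    fix T assume "T \<in> Tc"
    then obtain b where b: "b \<in> ?V" "T = face b" by (auto simp: Tc_def)
    show "inward_triangle P T" "\<not> forbidden P T"
      using hull_face_inward[OF hf[OF b(1)]] hull_face_not_forbidden[OF hf[OF b(1)]]
      by (simp_all add: b(2) face_def)
    fix U assume "U \<in> Tc" "T \<noteq> U"
    then obtain d where d: "d \<in> ?V" "U = face d" "b \<noteq> d" using b by (auto simp: Tc_def)
    note c = hull_faces_compatible[OF hf[OF b(1)] hf[OF d(1)] d(3)]
    show "triangle_edges T \<inter> triangle_edges U = {}" "fst T \<noteq> fst U"
      "triangle_interior T \<inter> triangle_interior U = {}"
      using c by (simp_all add: b(2) d(2) face_def)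
  qed
  have "maximal_compatible P Tc"
    unfolding maximal_compatible_def
  proof (intro conjI compat allI impI notI)
    fix T assume T: "inward_triangle P T \<and> T \<notin> Tc" and comp: "compatible P (insert T Tc)"
    then obtain b c where bc: "snd T = {b, c}" "closed_segment b c edge_of convex hull P"
      unfolding inward_triangle_def by blast
    \<comment> \<open>\<open>edge_of\<close> carries no direction; one of the two orders of the ends
      is the counterclockwise one.\<close>
    have "ccw_edge P b c \<or> ccw_edge P c b"
    proof -
      have flip: "orientation c b w = - orientation b c w" for w
        by (simp add: orientation_def algebra_simps)
      show ?thesis
        using edge_of_one_sided[OF finite_P bc(2)] bc(2)
        by (simp add: ccw_edge_def closed_segment_commute flip)
    qed
    then obtain d e where de: "snd T = {d, e}" "ccw_edge P d e"
      using bc(1) by (auto simp: insert_commute)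
    have dV: "d \<in> ?V" using ccw_edgeD(2,4)[OF de(2)] by (simp add: hull_vertices_def)
    \<comment> \<open>The face assigned to \<open>d\<close> has the same base as \<open>T\<close>,
      and compatible triangles share no edge.\<close>
    have "succ d = e" using ccw_edge_unique[OF no3 hull_faceD(1)[OF hf[OF dV]] de(2)] .
    then have "snd (face d) = snd T" using de(1) by (simp add: face_def)
    moreover have "face d \<in> Tc" using dV by (simp add: Tc_def)
    moreover have "face d \<noteq> T" using T \<open>face d \<in> Tc\<close> by auto
    ultimately have "triangle_edges T \<inter> triangle_edges (face d) = {}" "snd T \<in> triangle_edges (face d)"
      using comp unfolding compatible_def by (auto simp: triangle_edges_def)
    then show False by (auto simp: triangle_edges_def)
  qed
  then have le: "card (hull_inward P Tc) \<le> max_hull_inward P"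
    unfolding max_hull_inward_def
    using finite_maximal_compatible[OF finite_P] by (intro Max_ge) auto
  have finV: "finite ?V" and finI: "finite ?I"
    using finite_P by (simp_all add: hull_vertices_def interior_points_def)
  have finT: "finite Tc" using finV by (simp add: Tc_def)
  have "fst ` (Tc - hull_inward P Tc) \<subseteq> ?I - hull_vertices ?I"
    using hull_face_apex_interior[OF hf] by (auto simp: Tc_def face_def hull_inward_def)
  then have "card (Tc - hull_inward P Tc) \<le> card (?I - hull_vertices ?I)"
    using card_inj_on_le[OF inj_on_subset[OF fst_inj(1)]] finI by (metis Diff_subset finite_Diff)
  moreover have "card (?I - hull_vertices ?I) = card ?I - card (hull_vertices ?I)"
    using finI by (intro card_Diff_subset) (auto simp: hull_vertices_def intro: finite_subset)
  moreover have "card (hull_vertices ?I) \<le> card ?I"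
    using finI by (intro card_mono) (auto simp: hull_vertices_def)
  moreover have "card (Tc - hull_inward P Tc) = card Tc - card (hull_inward P Tc)"
    using finT by (intro card_Diff_subset) (auto simp: hull_inward_def intro: finite_subset)
  moreover have "card Tc = card ?V" unfolding Tc_def using fst_inj(2) by (rule card_image)
  ultimately show ?thesis using le by linarith
qed

end

section \<open>Extension to a maximal plane graph\<close>

lemma graph_connected_mono:
  assumes "E \<subseteq> F" "graph_connected V E"
  shows "graph_connected V F"
proof -
  have "{(x, y). x \<in> V \<and> y \<in> V \<and> {x, y} \<in> E}\<^sup>* \<subseteq> {(x, y). x \<in> V \<and> y \<in> V \<and> {x, y} \<in> F}\<^sup>*"
    using assms(1) by (intro rtrancl_mono) auto
  then show ?thesis using assms(2) unfolding graph_connected_def by blast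
qed

lemma four_connected_mono:
  assumes "E \<subseteq> F" "four_connected V E"
  shows "four_connected V F"
  unfolding four_connected_def
proof (intro conjI allI impI)
  show "5 \<le> card V" using assms(2) by (simp add: four_connected_def)
  fix S assume "S \<subseteq> V \<and> card S = 3"
  then have "graph_connected (V - S) {e \<in> E. e \<subseteq> V - S}"
    using assms(2) by (simp add: four_connected_def)
  then show "graph_connected (V - S) {e \<in> F. e \<subseteq> V - S}"
    by (rule graph_connected_mono[rotated]) (use assms(1) in auto)
qed

text \<open>There are only finitely many graphs on \<open>P\<close>, so some maximal plane one
  contains the given graph; additional edges preserve 4-connectivity.\<close>

lemma maximal_plane_graph_exists:
  assumes "finite P" "no_three_collinear P" "four_connectible P"
  obtains E where "maximal_plane_graph P E"
proof -
  obtain E where E: "plane_straight_line_graph P E" "four_connected P E"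
    using assms(3) unfolding four_connectible_def by blast
  let ?C = "{F. plane_straight_line_graph P F}"
  have "?C \<subseteq> Pow (Pow P)"
    by (auto simp: plane_straight_line_graph_def simple_graph_def)
  then have "finite ?C" by (rule finite_subset) (use assms(1) in simp)
  from finite_has_maximal2[OF this, of E] obtain F where F: "F \<in> ?C" "E \<subseteq> F" "\<forall>G\<in>?C. F \<subseteq> G \<longrightarrow> F = G"
    using E(1) by auto
  have "maximal_plane_graph P F"
    using assms F four_connected_mono[OF F(2) E(2)] by unfold_locales auto
  then show ?thesis by (rule that)
qed

theorem mainTheorem4:
  fixes P :: "(real^2) set"
  assumes "finite P"
    and "no_three_collinear P"
    and "four_connectible P"
  shows "int (card (interior_points P)) - int (card (hull_vertices (interior_points P)))
    \<ge> int (card (hull_vertices P)) - int (max_hull_inward P)"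
proof -
  obtain E where "maximal_plane_graph P E" using assms by (rule maximal_plane_graph_exists)
  from maximal_plane_graph.card_hull_vertices_le[OF this] show ?thesis by linarith
qed

end
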